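(* Let $r_1,r_2>0$ and let $f(x_1,x_2)=\sum_{k_1,k_2=0}^\infty b_{k_1,k_2}x_1^{k_1}x_2^{k_2}$ be a holomorphic function in $B_{r_1}(0)\times B_{r_2}(0)$. Let $\theta,\vartheta$ be random variables (defined jointly) with values in $S^1$ and put $\alpha_{k_1,k_2}:=\mathbb{E}[\theta^{k_1}\vartheta^{k_2}]$. Let $x_1,x_2\in\mathbb{C}$ with $|x_i|<\min(r_i,1)$ for $i=1,2$. If $b_{0,0}\notin\mathbb{Z}_{\le 0}$, then as $n\to\infty$ $$\mathbb{E}_n\left[W^1(f)(x_1,x_2)\right]\sim\frac{n^{b_{0,0}-1}}{\Gamma(b_{0,0})}\prod_{\substack{k_1,k_2\ge 0\\k_1+k_2\ne 0}}(1-x_1^{k_1}x_2^{k_2})^{-b_{k_1,k_2}\alpha_{k_1,k_2}}$$ and $$\mathbb{E}_n\left[W^2(f)(x_1,x_2)\right]\sim\frac{n^{b_{0,0}-1}}{\Gamma(b_{0,0})}\prod_{\substack{k_1,k_2\ge 0\\k_1+k_2\ne 0}}(1-\alpha_{k_1,k_2}x_1^{k_1}x_2^{k_2})^{-b_{k_1,k_2}}.$$ If $b_{0,0}\in\mathbb{Z}_{\le 0}$, then there exists $\delta=\delta(x_1,x_2)>0$ such that, as $n\to\infty$, $$\mathbb{E}_n\left[W^1(f)(x_1,x_2)\right]=O\left(\frac{1}{(1+\delta)^n}\right),\qquad \mathbb{E}_n\left[W^2(f)(x_1,x_2)\right]=O\left(\frac{1}{(1+\delta)^n}\right).$$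
   Context: $B_r(x_0)=\{x\in\mathbb{C}:|x-x_0|<r\}$. $\mathcal{S}_n$ is the group of permutations of $\{1,\dots,n\}$; $\mathcal{C}_\lambda\subset\mathcal{S}_n$ is the set of permutations with cycle-type the partition $\lambda=(\lambda_1,\dots,\lambda_{l(\lambda)})$ of $n$ (the $\lambda_m\geq 1$ are the cycle lengths, $l(\lambda)$ is the number of cycles). Complex powers $z^s$ are defined with the principal branch of the logarithm on $\mathbb{C}\setminus\mathbb{R}_{\le 0}$. $a_n\sim b_n$ means $a_n/b_n\to 1$. First randomized class function: for $g\in\mathcal{C}_\lambda$, $W^1(f)(x_1,x_2)(g):=\prod_{m=1}^{l(\lambda)}f(\theta_mx_1^{\lambda_m},\vartheta_mx_2^{\lambda_m})$, where the pairs $(\theta_m,\vartheta_m)$ are iid, distributed as $(\theta,\vartheta)$, and independent of $g$ (one pair per cycle). Second randomized class function: for $g\in\mathcal{C}_\lambda$, $W^2(f)(x_1,x_2)(g):=\prod_{m=1}^{l(\lambda)}f\big(x_1^{\lambda_m}\prod_{i=1}^{\lambda_m}\theta_i^{(m)},\,x_2^{\lambda_m}\prod_{i=1}^{\lambda_m}\vartheta_i^{(m)}\big)$, where the $n$ pairs $(\theta_i^{(m)},\vartheta_i^{(m)})$ are iid, distributed as $(\theta,\vartheta)$, and independent of $g$ (one pair per point). $\mathbb{E}_n[\cdot]$ denotes expectation over $g$ uniformly distributed on $\mathcal{S}_n$ and over the auxiliary random variables. *)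

theory Defs
  imports
    "HOL-Probability.Probability"
    "HOL-Combinatorics.Combinatorics"
begin

definition holomorphic2_on :: "(complex \<times> complex \<Rightarrow> complex) \<Rightarrow> (complex \<times> complex) set \<Rightarrow> bool" where
  "holomorphic2_on f S \<longleftrightarrow>
     (\<forall>z\<in>S. \<exists>A B. (f has_derivative (\<lambda>h. A * fst h + B * snd h)) (at z within S))"

text \<open>
  The parts \<open>\<lambda>\<^sub>1 \<ge> \<lambda>\<^sub>2 \<ge> \<dots>\<close> of the cycle type of a permutation of \<open>{1..n}\<close>. Fixed points count as
  cycles of length \<open>1\<close>. The part \<open>\<lambda>\<^sub>m\<close> is the list element number \<open>m - 1\<close>, and accordingly all
  cycle indices \<open>m\<close> (and the indices \<open>i\<close> inside a cycle) below start at \<open>0\<close>.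
\<close>

definition cycle_type :: "nat \<Rightarrow> (nat \<Rightarrow> nat) \<Rightarrow> nat list" where
  "cycle_type n g = rev (sorted_list_of_multiset (image_mset card (mset_set (orbit g ` {1..n}))))"

text \<open>
  The arguments \<open>T\<close> and \<open>V\<close> are realisations of the auxiliary random variables: one pair
  \<open>(T m, V m)\<close> per cycle in \<open>W1\<close>, one pair \<open>(T (m, i), V (m, i))\<close> per point in \<open>W2\<close>.
\<close>

definition W1 :: "(complex \<times> complex \<Rightarrow> complex) \<Rightarrow> complex \<Rightarrow> complex \<Rightarrow> nat \<Rightarrow>
    (nat \<Rightarrow> complex) \<Rightarrow> (nat \<Rightarrow> complex) \<Rightarrow> (nat \<Rightarrow> nat) \<Rightarrow> complex" where
  "W1 f x1 x2 n T V g =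
     (let l = cycle_type n g in
      \<Prod>m<length l. f (T m * x1 ^ (l ! m), V m * x2 ^ (l ! m)))"

definition W2 :: "(complex \<times> complex \<Rightarrow> complex) \<Rightarrow> complex \<Rightarrow> complex \<Rightarrow> nat \<Rightarrow>
    (nat \<times> nat \<Rightarrow> complex) \<Rightarrow> (nat \<times> nat \<Rightarrow> complex) \<Rightarrow> (nat \<Rightarrow> nat) \<Rightarrow> complex" where
  "W2 f x1 x2 n T V g =
     (let l = cycle_type n g in
      \<Prod>m<length l. f (x1 ^ (l ! m) * (\<Prod>i<l ! m. T (m, i)), x2 ^ (l ! m) * (\<Prod>i<l ! m. V (m, i))))"

text \<open>
  The group element is uniform on the permutations of \<open>{1..n}\<close>. Independent copies of the pair
  \<open>(\<theta>, \<eta>)\<close>, which lives on \<open>M\<close>, are realised on a power of \<open>M\<close>: the copy with index \<open>j\<close> is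
  \<open>(\<theta> (\<omega> j), \<eta> (\<omega> j))\<close>. The product with the uniform measure makes them independent of the
  permutation. The second variable is called \<open>\<eta>\<close> because vartheta is not an identifier letter.
\<close>

definition auxiliary_space :: "'w measure \<Rightarrow> nat \<Rightarrow> ((nat \<Rightarrow> nat) \<times> ('i \<Rightarrow> 'w)) measure" where
  "auxiliary_space M n = uniform_count_measure {g. g permutes {1..n}} \<Otimes>\<^sub>M (\<Pi>\<^sub>M j\<in>UNIV. M)"

definition EW1 :: "'w measure \<Rightarrow> ('w \<Rightarrow> complex) \<Rightarrow> ('w \<Rightarrow> complex) \<Rightarrow>
    (complex \<times> complex \<Rightarrow> complex) \<Rightarrow> complex \<Rightarrow> complex \<Rightarrow> nat \<Rightarrow> complex" where
  "EW1 M \<theta> \<eta> f x1 x2 n =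
     (LINT (g, \<omega>)|auxiliary_space M n. W1 f x1 x2 n (\<lambda>m. \<theta> (\<omega> m)) (\<lambda>m. \<eta> (\<omega> m)) g)"

definition EW2 :: "'w measure \<Rightarrow> ('w \<Rightarrow> complex) \<Rightarrow> ('w \<Rightarrow> complex) \<Rightarrow>
    (complex \<times> complex \<Rightarrow> complex) \<Rightarrow> complex \<Rightarrow> complex \<Rightarrow> nat \<Rightarrow> complex" where
  "EW2 M \<theta> \<eta> f x1 x2 n =
     (LINT (g, \<omega>)|auxiliary_space M n. W2 f x1 x2 n (\<lambda>j. \<theta> (\<omega> j)) (\<lambda>j. \<eta> (\<omega> j)) g)"

text \<open>
  Unconditional convergence of an infinite product over an arbitrary index set to a nonzero
  value, the multiplicative counterpart of \<open>has_sum\<close>.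
\<close>

definition has_unordered_prod :: "('a \<Rightarrow> complex) \<Rightarrow> complex \<Rightarrow> 'a set \<Rightarrow> bool" where
  "has_unordered_prod u P K \<longleftrightarrow> (prod u \<longlongrightarrow> P) (finite_subsets_at_top K) \<and> P \<noteq> 0"

end

theory Submission
  imports Defs "HOL-Complex_Analysis.Complex_Analysis"
begin

text \<open>
  Given the permutation, the factors of \<open>W\<^sup>1\<close> and of \<open>W\<^sup>2\<close> belonging to different cycles depend on
  disjoint blocks of the auxiliary variables. Hence the conditional expectation is a product over
  the cycles, and a cycle of length \<open>l\<close> contributes a number \<open>c(l)\<close> that is found by integrating
  the power series of \<open>f\<close> term by term (\<open>block_expectation\<close>, \<open>prod_block_expectation\<close>). In both
  cases \<open>c(l) = \<Sum>\<^sub>k \<beta>\<^sub>k w\<^sub>k\<^sup>l\<close>, where \<open>k\<close> runs over the pairs \<open>(k\<^sub>1, k\<^sub>2)\<close>: for \<open>W\<^sup>1\<close> with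
  \<open>\<beta>\<^sub>k = b\<^sub>k \<alpha>\<^sub>k\<close> and \<open>w\<^sub>k = x\<^sup>k\<close>, and for \<open>W\<^sup>2\<close> with \<open>\<beta>\<^sub>k = b\<^sub>k\<close> and \<open>w\<^sub>k = \<alpha>\<^sub>k x\<^sup>k\<close>.

  Let \<open>s(n)\<close> be the average over the permutations of \<open>n\<close> points of the product of \<open>c\<close> over the cycle
  lengths. Splitting off the cycle through a chosen point gives
  \<open>n s(n) = c(1) s(n - 1) + \<dots> + c(n) s(0)\<close> (\<open>cycle_weight_sum_recurrence\<close>), so that
  \<open>\<Sum>\<^sub>n s(n) t\<^sup>n = exp (\<Sum>\<^sub>l c(l) t\<^sup>l / l)\<close>. The index \<open>k = (0, 0)\<close> contributes the constant
  \<open>B = b\<^sub>0\<^sub>0\<close> to \<open>c(l)\<close>. The remainder \<open>d(l) = c(l) - B\<close> is \<open>O(\<rho>\<^sup>l)\<close> for some \<open>\<rho> < 1\<close>, since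
  \<open>\<bar>w\<^sub>k\<bar> \<le> \<rho>\<close> for all other \<open>k\<close> and \<open>\<Sum>\<^sub>k \<bar>\<beta>\<^sub>k w\<^sub>k\<bar>\<close> is finite. The generating function is therefore \<open>(1 - t)\<^sup>-\<^sup>B H(t)\<close>, where
  \<open>H(t) = exp (\<Sum>\<^sub>l d(l) t\<^sup>l / l)\<close> has a radius of convergence of at least \<open>1 / \<rho> > 1\<close>.

  Comparing coefficients, \<open>s\<close> is the convolution of the coefficients \<open>h\<close> of \<open>H\<close> with
  \<open>p(m) = B (B + 1) \<dots> (B + m - 1) / m!\<close>. If \<open>B\<close> is not a nonpositive integer, then
  \<open>p(n - j) / p(n)\<close> tends to \<open>1\<close> for every \<open>j\<close> and is at most a constant times \<open>R\<^sup>j\<close> for any given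
  \<open>R > 1\<close> and large \<open>n\<close>, so \<open>s(n) / p(n)\<close> tends to \<open>H(1)\<close> by dominated convergence for series
  (\<open>convolution_asymp\<close>), while \<open>p(n)\<close> is asymptotic to \<open>n\<^sup>B\<^sup>-\<^sup>1 / \<Gamma>(B)\<close> by the product formula for
  the Gamma function. If \<open>B\<close> is a nonpositive integer, \<open>p\<close> vanishes from some point on, and \<open>s\<close>
  decays exponentially because \<open>h\<close> does (\<open>convolution_exponentially_small\<close>).

  Finally, \<open>H(1)\<close> is the infinite product: \<open>\<Sum>\<^sub>l d(l) / l\<close> is an absolutely convergent double sum over
  \<open>l\<close> and \<open>k\<close>, and summing over \<open>l\<close> first gives \<open>\<Sum>\<^sub>k - \<beta>\<^sub>k log (1 - w\<^sub>k)\<close>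
  (\<open>has_unordered_prod_powr\<close>).
\<close>

section \<open>Sums over permutations weighted by cycle lengths\<close>

text \<open>
  The sum over all permutations of \<open>A\<close> of the product of \<open>c\<close> over the cycle lengths. The cycles are
  the orbits of the points of \<open>A\<close>, taken as a set, so that each cycle counts once; fixed points are
  cycles of length \<open>1\<close>.
\<close>

definition cycle_weight_sum :: "(nat \<Rightarrow> 'b::comm_ring_1) \<Rightarrow> 'a set \<Rightarrow> 'b" where
  "cycle_weight_sum c A = (\<Sum>g | g permutes A. \<Prod>U\<in>orbit g ` A. c (card U))"

text \<open>The cyclic permutations of a set \<open>B\<close> that contains \<open>a\<close>: the orbit of \<open>a\<close> is all of \<open>B\<close>.\<close>

definition cyclic_perms :: "'a \<Rightarrow> 'a set \<Rightarrow> ('a \<Rightarrow> 'a) set" where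
  "cyclic_perms a B = {h. h permutes B \<and> orbit h a = B}"

lemma perm_restrict_orbit_permutes:
  assumes "g permutes A" "finite A" "a \<in> A"
  shows "perm_restrict g (orbit g a) permutes orbit g a"
proof (rule bij_imp_permutes)
  have "orbit g a \<subseteq> A" using assms by (intro permutes_orbit_subset)
  hence "finite (orbit g a)" using assms(2) by (rule finite_subset)
  moreover have "g ` orbit g a \<subseteq> orbit g a" by (auto intro: orbit.step)
  moreover have "inj_on g (orbit g a)" using permutes_inj_on[OF assms(1)] .
  ultimately have "bij_betw g (orbit g a) (orbit g a)"
    by (simp add: bij_betw_def endo_inj_surj)
  thus "bij_betw (perm_restrict g (orbit g a)) (orbit g a) (orbit g a)"
    by (rule bij_betw_cong[THEN iffD1, rotated]) (simp add: perm_restrict_simps)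
qed (simp add: perm_restrict_simps)

text \<open>
  The permutations of \<open>A\<close> in which the cycle of \<open>a\<close> has support \<open>B\<close> correspond to pairs of a cyclic
  permutation of \<open>B\<close> and an arbitrary permutation of \<open>A - B\<close>.
\<close>

lemma bij_betw_split_cycle:
  assumes "finite A" "a \<in> B" "B \<subseteq> A"
  shows "bij_betw (\<lambda>(h, k). h \<circ> k) (cyclic_perms a B \<times> {k. k permutes A - B})
           {g. g permutes A \<and> orbit g a = B}"
proof (rule bij_betw_byWitness[where f' = "\<lambda>g. (perm_restrict g B, perm_restrict g (A - B))"])
  show "\<forall>p\<in>cyclic_perms a B \<times> {k. k permutes A - B}.
     (perm_restrict ((\<lambda>(h, k). h \<circ> k) p) B, perm_restrict ((\<lambda>(h, k). h \<circ> k) p) (A - B)) = p"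
  proof (clarsimp, intro conjI ext)
    fix h k x assume "h \<in> cyclic_perms a B" and k: "k permutes A - B"
    hence h: "h permutes B" by (simp add: cyclic_perms_def)
    show "perm_restrict (h \<circ> k) B x = h x"
      using permutes_not_in[OF k, of x] permutes_not_in[OF h, of x]
      by (auto simp: perm_restrict_def)
    show "perm_restrict (h \<circ> k) (A - B) x = k x"
      using permutes_not_in[OF k, of x] permutes_not_in[OF h, of "k x"] permutes_in_image[OF k, of x]
      by (auto simp: perm_restrict_def)
  qed
  show "\<forall>g\<in>{g. g permutes A \<and> orbit g a = B}.
     (\<lambda>(h, k). h \<circ> k) (perm_restrict g B, perm_restrict g (A - B)) = g"
  proof (clarsimp)
    fix g assume g: "g permutes A" and B: "B = orbit g a"
    have "perm_restrict g B \<circ> perm_restrict g (A - B) = perm_restrict g (B \<union> (A - B))"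
      using g assms B
      by (intro perm_restrict_union perm_restrict_diff_cyclic)
         (auto simp: perm_restrict_orbit_permutes intro: cyclic_on_orbit[OF g assms(1)])
    also have "\<dots> = g" using g assms(3) by (simp add: Un_absorb1)
    finally show "perm_restrict g (orbit g a) \<circ> perm_restrict g (A - orbit g a) = g"
      by (simp add: B)
  qed
  show "(\<lambda>(h, k). h \<circ> k) ` (cyclic_perms a B \<times> {k. k permutes A - B}) \<subseteq> {g. g permutes A \<and> orbit g a = B}"
  proof (rule image_subsetI, clarify)
    fix h k assume "h \<in> cyclic_perms a B" and k: "k permutes A - B"
    hence h: "h permutes B" "orbit h a = B" by (simp_all add: cyclic_perms_def)
    have "h permutes A" "k permutes A"
      using h k assms by (auto intro: permutes_subset)
    hence "h \<circ> k permutes A" by (intro permutes_compose)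
    moreover have "orbit (h \<circ> k) a = orbit h a"
      using assms h by (intro orbit_cong) (auto simp: permutes_not_in[OF k])
    ultimately show "h \<circ> k permutes A \<and> orbit (h \<circ> k) a = B"
      using h by blast
  qed
  show "(\<lambda>g. (perm_restrict g B, perm_restrict g (A - B))) ` {g. g permutes A \<and> orbit g a = B}
     \<subseteq> cyclic_perms a B \<times> {k. k permutes A - B}"
  proof (clarsimp, intro conjI)
    fix g assume g: "g permutes A" and B: "B = orbit g a"
    have "orbit (perm_restrict g B) a = orbit g a"
      using assms B by (intro orbit_cong) (auto simp: perm_restrict_simps)
    thus "perm_restrict g (orbit g a) \<in> cyclic_perms a (orbit g a)"
      using perm_restrict_orbit_permutes[OF g assms(1)] assms B by (auto simp: cyclic_perms_def)
    show "perm_restrict g (A - orbit g a) permutes A - orbit g a"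
      using g assms(1) by (intro perm_restrict_diff_cyclic cyclic_on_orbit)
  qed
qed

lemma orbits_split_cycle:
  assumes "finite A" "a \<in> B" "B \<subseteq> A" "h \<in> cyclic_perms a B" "k permutes A - B"
  shows "orbit (h \<circ> k) ` A = insert B (orbit k ` (A - B))" and "B \<notin> orbit k ` (A - B)"
proof -
  have h: "h permutes B" "orbit h a = B" using assms(4) by (auto simp: cyclic_perms_def)
  have fin: "finite B" "finite (A - B)" using assms by (auto intro: finite_subset)
  have hB: "orbit h x = B" if "x \<in> B" for x
    using cyclic_on_orbit[OF h(1) fin(1), of a] orbit_cyclic_eq3[of h B x] that h(2) by simp
  have oB: "orbit (h \<circ> k) x = B" if "x \<in> B" for x
  proof -
    have "orbit (h \<circ> k) x = orbit h x"
      using that hB[OF that] by (intro orbit_cong) (auto simp: permutes_not_in[OF assms(5)])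
    thus ?thesis using hB[OF that] by simp
  qed
  have sub: "orbit k x \<subseteq> A - B" if "x \<in> A - B" for x
    using permutes_orbit_subset[OF assms(5) that] .
  have oAB: "orbit (h \<circ> k) x = orbit k x" if "x \<in> A - B" for x
  proof (rule orbit_cong)
    show "x \<in> orbit k x"
      using assms(5) fin by (intro permutation_self_in_orbit) (auto simp: permutation_permutes)
    fix s assume "s \<in> orbit k x"
    hence "k s \<in> A - B" using sub[OF that] orbit.step by fast
    thus "(h \<circ> k) s = k s" using permutes_not_in[OF h(1)] by simp
  qed
  have "orbit (h \<circ> k) ` A = orbit (h \<circ> k) ` (B \<union> (A - B))"
    by (rule arg_cong[where f = "(`) _"]) (use assms(3) in auto)
  also have "\<dots> = orbit (h \<circ> k) ` B \<union> orbit (h \<circ> k) ` (A - B)"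
    by (rule image_Un)
  also have "orbit (h \<circ> k) ` B = {B}" using oB assms(2) by auto
  also have "orbit (h \<circ> k) ` (A - B) = orbit k ` (A - B)" using oAB by auto
  also have "{B} \<union> orbit k ` (A - B) = insert B (orbit k ` (A - B))" by simp
  finally show "orbit (h \<circ> k) ` A = insert B (orbit k ` (A - B))" .
  show "B \<notin> orbit k ` (A - B)"
    using sub assms(2) by blast
qed

lemma cycle_weight_sum_split:
  assumes "finite A" "a \<in> A"
  shows "cycle_weight_sum c A =
    (\<Sum>B | a \<in> B \<and> B \<subseteq> A. of_nat (card (cyclic_perms a B)) * c (card B) * cycle_weight_sum c (A - B))"
proof -
  define w where "w g = (\<Prod>U\<in>orbit g ` A. c (card U))" for g
  have fin: "finite {g. g permutes A}" using assms(1) by (rule finite_permutations)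
  have finB: "finite {B. a \<in> B \<and> B \<subseteq> A}" using assms(1) by simp
  have "orbit g a \<subseteq> A" "a \<in> orbit g a" if "g permutes A" for g
    using that assms by (auto intro!: permutation_self_in_orbit simp: permutation_permutes 
        dest: permutes_orbit_subset)
  hence "cycle_weight_sum c A = (\<Sum>B | a \<in> B \<and> B \<subseteq> A. \<Sum>g | g \<in> {g. g permutes A} \<and> orbit g a = B. w g)"
    unfolding cycle_weight_sum_def w_def[symmetric]
    by (intro sum.group[symmetric] fin finB) auto
  also have "\<dots> = (\<Sum>B | a \<in> B \<and> B \<subseteq> A. of_nat (card (cyclic_perms a B)) * c (card B) * cycle_weight_sum c (A - B))"
  proof (intro sum.cong refl)
    fix B assume "B \<in> {B. a \<in> B \<and> B \<subseteq> A}"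
    hence B: "a \<in> B" "B \<subseteq> A" by auto
    have "(\<Sum>g | g \<in> {g. g permutes A} \<and> orbit g a = B. w g) =
      (\<Sum>(h, k)\<in>cyclic_perms a B \<times> {k. k permutes A - B}. w (h \<circ> k))"
      using sum.reindex_bij_betw[OF bij_betw_split_cycle[OF assms(1) B], of w]
      by (simp add: case_prod_unfold)
    also have "\<dots> = (\<Sum>h\<in>cyclic_perms a B. \<Sum>k | k permutes A - B. w (h \<circ> k))"
      by (simp add: sum.cartesian_product)
    also have "\<dots> = (\<Sum>h\<in>cyclic_perms a B. \<Sum>k | k permutes A - B. 
        c (card B) * (\<Prod>U\<in>orbit k ` (A - B). c (card U)))"
      unfolding w_def using orbits_split_cycle[OF assms(1) B] assms(1)
      by (intro sum.cong refl) simp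
    also have "\<dots> = of_nat (card (cyclic_perms a B)) * c (card B) * cycle_weight_sum c (A - B)"
      by (simp add: cycle_weight_sum_def sum_distrib_left mult.assoc)
    finally show "(\<Sum>g | g \<in> {g. g permutes A} \<and> orbit g a = B. w g) = \<dots>" .
  qed
  finally show ?thesis .
qed

text \<open>
  There are \<open>(n - 1) choose (l - 1)\<close> subsets of size \<open>l\<close> that contain \<open>a\<close>; the factorials in the
  summand cancel this number up to \<open>(n - 1)!\<close>.
\<close>

lemma sum_subsets_containing:
  fixes \<phi> :: "nat \<Rightarrow> 'b::field_char_0"
  assumes "finite A" "a \<in> A"
  shows "(\<Sum>B | a \<in> B \<and> B \<subseteq> A. fact (card B - 1) * fact (card A - card B) * \<phi> (card B))
       = fact (card A - 1) * (\<Sum>l=1..card A. \<phi> l)"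
proof -
  define n where "n = card A"
  have card_pos: "card B \<in> {1..n}" if "a \<in> B" "B \<subseteq> A" for B
    using that assms card_mono[OF assms(1) that(2)] card_gt_0_iff[of B] finite_subset[of B A]
    by (auto simp: n_def Suc_le_eq)
  have "finite {B. a \<in> B \<and> B \<subseteq> A}" using assms(1) by simp
  moreover have "card ` {B. a \<in> B \<and> B \<subseteq> A} \<subseteq> {1..n}" using card_pos by blast
  ultimately have "(\<Sum>B | a \<in> B \<and> B \<subseteq> A. fact (card B - 1) * fact (card A - card B) * \<phi> (card B)) =
    (\<Sum>l=1..n. \<Sum>B | B \<in> {B. a \<in> B \<and> B \<subseteq> A} \<and> card B = l. 
      fact (card B - 1) * fact (card A - card B) * \<phi> (card B))"
    by (intro sum.group[symmetric] finite_atLeastAtMost)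
  also have "\<dots> = (\<Sum>l=1..n. fact (n - 1) * \<phi> l)"
  proof (intro sum.cong refl)
    fix l assume l: "l \<in> {1..n}"
    have "card {B. B \<in> {B. a \<in> B \<and> B \<subseteq> A} \<and> card B = l} = card {C. C \<subseteq> A - {a} \<and> card C = l - 1}"
    proof (rule bij_betw_same_card[of "\<lambda>B. B - {a}"])
      show "bij_betw (\<lambda>B. B - {a}) {B. B \<in> {B. a \<in> B \<and> B \<subseteq> A} \<and> card B = l}
        {C. C \<subseteq> A - {a} \<and> card C = l - 1}"
      proof (rule bij_betw_byWitness[where f' = "insert a"])
        show "insert a ` {C. C \<subseteq> A - {a} \<and> card C = l - 1} \<subseteq> {B. B \<in> {B. a \<in> B \<and> B \<subseteq> A} \<and> card B = l}"
        proof (rule image_subsetI)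
          fix C assume "C \<in> {C. C \<subseteq> A - {a} \<and> card C = l - 1}"
          hence C: "C \<subseteq> A - {a}" "card C = l - 1" by auto
          hence "finite C" "a \<notin> C" using assms(1) by (auto intro: finite_subset)
          thus "insert a C \<in> {B. B \<in> {B. a \<in> B \<and> B \<subseteq> A} \<and> card B = l}"
            using C l assms(2) by auto
        qed
      qed (use assms in auto)
    qed
    also have "\<dots> = (n - 1) choose (l - 1)"
      using assms by (subst n_subsets) (auto simp: n_def)
    finally have card: "card {B. B \<in> {B. a \<in> B \<and> B \<subseteq> A} \<and> card B = l} = (n - 1) choose (l - 1)" .
    have "(fact (l - 1) * fact (n - l)) * ((n - 1) choose (l - 1)) = (fact (n - 1) :: nat)"
      using l binomial_fact_lemma[of "l - 1" "n - 1"] by (auto simp: mult_ac)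
    hence "of_nat ((fact (l - 1) * fact (n - l)) * ((n - 1) choose (l - 1))) = (of_nat (fact (n - 1)) :: 'b)"
      by (rule arg_cong)
    hence fct: "fact (l - 1) * fact (n - l) * of_nat ((n - 1) choose (l - 1)) = (fact (n - 1) :: 'b)"
      by (simp only: of_nat_mult of_nat_fact)
    have "(\<Sum>B | B \<in> {B. a \<in> B \<and> B \<subseteq> A} \<and> card B = l. 
        fact (card B - 1) * fact (card A - card B) * \<phi> (card B)) =
      (\<Sum>B | B \<in> {B. a \<in> B \<and> B \<subseteq> A} \<and> card B = l. fact (l - 1) * fact (n - l) * \<phi> l)"
      by (intro sum.cong) (auto simp: n_def)
    also have "\<dots> = (fact (l - 1) * fact (n - l) * of_nat ((n - 1) choose (l - 1))) * \<phi> l"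
      unfolding sum_constant card by (simp add: mult_ac)
    finally show "(\<Sum>B | B \<in> {B. a \<in> B \<and> B \<subseteq> A} \<and> card B = l. 
        fact (card B - 1) * fact (card A - card B) * \<phi> (card B)) = fact (n - 1) * \<phi> l"
      unfolding fct .
  qed
  finally show ?thesis by (simp add: sum_distrib_left n_def)
qed

text \<open>
  This needs no explicit enumeration of the cyclic permutations. Splitting off the cycle of \<open>a\<close> with
  all weights equal to \<open>1\<close> expresses \<open>n!\<close> through the number of cyclic permutations of the subsets
  containing \<open>a\<close>. By the induction hypothesis this number is known for proper subsets, and the
  identity then leaves only one possible value for the whole set.
\<close>

lemma card_cyclic_perms:
  assumes "finite B" "a \<in> B"
  shows "card (cyclic_perms a B) = fact (card B - 1)"
  using assms
proof (induction "card B" arbitrary: B rule: less_induct)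
  case less
  define n where "n = card B"
  have n: "n > 0" using less.prems by (auto simp: n_def card_gt_0_iff)
  have perms: "cycle_weight_sum (\<lambda>_. 1) C = (fact (card C) :: rat)" if "finite C" for C :: "'a set"
    using that by (simp add: cycle_weight_sum_def card_permutations)
  let ?S = "{C. a \<in> C \<and> C \<subseteq> B}"
  let ?f = "\<lambda>C. fact (card C - 1) * fact (n - card C) :: rat"
  have fin: "finite ?S" using less.prems by simp
  have "fact n = (\<Sum>C\<in>?S. of_nat (card (cyclic_perms a C)) * cycle_weight_sum (\<lambda>_. 1) (B - C) :: rat)"
    using cycle_weight_sum_split[OF less.prems, of "\<lambda>_. 1 :: rat"] perms[OF less.prems(1)]
    by (simp add: n_def)
  also have "\<dots> = of_nat (card (cyclic_perms a B)) + 
      (\<Sum>C\<in>?S - {B}. of_nat (card (cyclic_perms a C)) * cycle_weight_sum (\<lambda>_. 1) (B - C))"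
    using less.prems by (subst sum.remove[OF fin, of B]) (auto simp: perms)
  also have "(\<Sum>C\<in>?S - {B}. of_nat (card (cyclic_perms a C)) * cycle_weight_sum (\<lambda>_. 1) (B - C)) =
      (\<Sum>C\<in>?S - {B}. ?f C)"
  proof (intro sum.cong refl)
    fix C assume C: "C \<in> ?S - {B}"
    hence "C \<subset> B" by auto
    hence "card C < card B" "finite C" 
      using less.prems(1) by (auto intro: psubset_card_mono finite_subset)
    hence "card (cyclic_perms a C) = fact (card C - 1)" using less.hyps C by auto
    moreover have "card (B - C) = n - card C"
      using \<open>finite C\<close> C by (simp add: n_def card_Diff_subset)
    ultimately show "of_nat (card (cyclic_perms a C)) * cycle_weight_sum (\<lambda>_. 1) (B - C) = ?f C"
      using less.prems(1) by (simp add: perms)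
  qed
  also have "(\<Sum>C\<in>?S - {B}. ?f C) = (\<Sum>C\<in>?S. ?f C) - ?f B"
    using less.prems by (subst sum_diff1[OF fin]) auto
  also have "(\<Sum>C\<in>?S. ?f C) = fact (n - 1) * of_nat n"
    using sum_subsets_containing[OF less.prems, of "\<lambda>_. 1 :: rat"] by (simp add: n_def)
  also have "fact (n - 1) * of_nat n = (fact n :: rat)"
    using n by (cases n) (simp_all add: mult.commute)
  also have "?f B = of_nat (fact (card B - 1))" by (simp add: n_def)
  finally have "of_nat (card (cyclic_perms a B)) = (of_nat (fact (card B - 1)) :: rat)"
    by simp
  thus ?case by (simp only: of_nat_eq_iff)
qed

text \<open>
  The recurrence says that \<open>t S'(t) = (\<Sum>\<^sub>l c(l) t\<^sup>l) S(t)\<close> for \<open>S(t) = \<Sum>\<^sub>n s(n) t\<^sup>n\<close>, which is the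
  exponential formula \<open>S(t) = exp (\<Sum>\<^sub>l c(l) t\<^sup>l / l)\<close> in differentiated form.
\<close>

lemma cycle_weight_sum_recurrence:
  fixes c :: "nat \<Rightarrow> 'b::field_char_0"
  defines "s \<equiv> \<lambda>n. cycle_weight_sum c {1..n} / fact n"
  shows "s 0 = 1" and "n > 0 \<Longrightarrow> of_nat n * s n = (\<Sum>l=1..n. c l * s (n - l))"
proof -
  show "s 0 = 1" by (simp add: s_def cycle_weight_sum_def)
  have s: "cycle_weight_sum c {1..n} = fact n * s n" for n by (simp add: s_def)
  \<comment> \<open>Splitting off a cycle leaves the sum over a set other than an initial segment, so it has to be
      shown along the way that the weighted sum depends on the size of the set only.\<close>
  have key: "cycle_weight_sum c A = fact (n - 1) * (\<Sum>l=1..n. c l * s (n - l))"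
    if IH: "\<And>B :: nat set. finite B \<Longrightarrow> card B < n \<Longrightarrow> cycle_weight_sum c B = fact (card B) * s (card B)"
      and A: "finite A" "card A = n" "n > 0" for A :: "nat set" and n
  proof -
    obtain a where a: "a \<in> A" using A by fastforce
    have "cycle_weight_sum c A = (\<Sum>B | a \<in> B \<and> B \<subseteq> A. 
        fact (card B - 1) * fact (card A - card B) * (c (card B) * s (n - card B)))"
      unfolding cycle_weight_sum_split[OF A(1) a]
    proof (intro sum.cong refl)
      fix B assume "B \<in> {B. a \<in> B \<and> B \<subseteq> A}"
      hence B: "a \<in> B" "B \<subseteq> A" "finite B" using A(1) by (auto intro: finite_subset)
      have card: "card (A - B) = n - card B" using B A by (simp add: card_Diff_subset)
      moreover have "card B > 0" using B by (auto simp: card_gt_0_iff)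
      ultimately have "cycle_weight_sum c (A - B) = fact (n - card B) * s (n - card B)"
        using IH[of "A - B"] A by simp
      thus "of_nat (card (cyclic_perms a B)) * c (card B) * cycle_weight_sum c (A - B) =
        fact (card B - 1) * fact (card A - card B) * (c (card B) * s (n - card B))"
        using B A by (simp add: card_cyclic_perms mult_ac)
    qed
    also have "\<dots> = fact (n - 1) * (\<Sum>l=1..n. c l * s (n - l))"
      using sum_subsets_containing[OF A(1) a, of "\<lambda>l. c l * s (n - l)"] A by simp
    finally show ?thesis .
  qed
  have all: "cycle_weight_sum c A = fact n * s n" if "finite A" "card A = n" for A :: "nat set" and n
    using that
  proof (induction n arbitrary: A rule: less_induct)
    case (less n)
    show ?case
    proof (cases "n = 0")
      case True
      thus ?thesis using less.prems s[of 0] by simp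
    next
      case False
      have "cycle_weight_sum c A = cycle_weight_sum c {1..n}"
        using key[of n A] key[of n "{1..n}"] less.IH less.prems False by simp
      thus ?thesis by (simp only: s)
    qed
  qed
  assume "n > 0"
  have "fact n * s n = fact (n - 1) * (\<Sum>l=1..n. c l * s (n - l))"
    unfolding s[symmetric] using \<open>n > 0\<close> by (intro key all) auto
  moreover have "fact n = (fact (n - 1) * of_nat n :: 'b)"
    using \<open>n > 0\<close> by (cases n) (simp_all add: mult.commute)
  ultimately have "fact (n - 1) * (of_nat n * s n) = fact (n - 1) * (\<Sum>l=1..n. c l * s (n - l))"
    by (simp only: mult.assoc)
  thus "of_nat n * s n = (\<Sum>l=1..n. c l * s (n - l))" by simp
qed

lemma prod_cycle_type:
  fixes c :: "nat \<Rightarrow> 'b::comm_monoid_mult"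
  shows "(\<Prod>m<length (cycle_type n g). c (cycle_type n g ! m)) = (\<Prod>U\<in>orbit g ` {1..n}. c (card U))"
proof -
  have "(\<Prod>m<length (cycle_type n g). c (cycle_type n g ! m)) = prod_list (map c (cycle_type n g))"
    by (simp add: prod.list_conv_set_nth atLeast0LessThan)
  also have "\<dots> = prod_mset (image_mset c (mset (cycle_type n g)))"
    by (simp flip: prod_mset_prod_list)
  also have "\<dots> = (\<Prod>U\<in>orbit g ` {1..n}. c (card U))"
    by (simp add: cycle_type_def prod_unfold_prod_mset image_mset.compositionality comp_def)
  finally show ?thesis .
qed

lemma cycle_type_pos:
  assumes "g permutes {1..n}" "m < length (cycle_type n g)"
  shows "cycle_type n g ! m > 0"
proof -
  have "cycle_type n g ! m \<in># mset (cycle_type n g)" using assms(2) by simp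
  hence "cycle_type n g ! m \<in> card ` orbit g ` {1..n}" by (simp add: cycle_type_def)
  then obtain x where x: "x \<in> {1..n}" "cycle_type n g ! m = card (orbit g x)" by auto
  have "finite (orbit g x)" 
    using permutes_orbit_subset[OF assms(1) x(1)] by (rule finite_subset) simp
  thus ?thesis using x(2) orbit_nonempty[of g x] by (simp add: card_gt_0_iff)
qed

section \<open>Coefficient asymptotics of the generating function\<close>

text \<open>
  The exponential \<open>H\<close> of a convergent power series \<open>L\<close>, obtained as the Taylor series at \<open>0\<close> of the
  holomorphic function \<open>exp (L(z))\<close>. It therefore converges wherever \<open>L\<close> does.
\<close>

lemma exp_power_series:
  fixes L :: "complex fps"
  assumes "fps_conv_radius L > 0"
  obtains H where "fps_nth H 0 = exp (fps_nth L 0)" "fps_deriv H = fps_deriv L * H"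
    "fps_conv_radius H \<ge> fps_conv_radius L"
    "\<And>z. ereal (norm z) < fps_conv_radius L \<Longrightarrow> eval_fps H z = exp (eval_fps L z)"
proof -
  define r where "r = fps_conv_radius L"
  define G where "G = (\<lambda>z. exp (eval_fps L z))"
  define H where "H = fps_expansion G 0"
  have holo: "G holomorphic_on eball 0 r"
    unfolding G_def r_def by (intro holomorphic_intros) auto
  have rad: "fps_conv_radius H \<ge> r"
    unfolding H_def by (rule conv_radius_fps_expansion[OF holo])
  have ev: "eval_fps H z = exp (eval_fps L z)" if "ereal (norm z) < r" for z
    using eval_fps_expansion'[OF holo that] by (simp add: H_def G_def)
  have r0: "0 < r" using assms by (simp add: r_def)
  have L: "eval_fps L has_fps_expansion L"
    using assms by (rule eval_fps_has_fps_expansion)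
  have near: "eventually (\<lambda>z. z \<in> eball 0 r) (nhds (0::complex))"
    using r0 by (intro eventually_nhds_in_open) (auto simp: zero_ereal_def)
  have "G has_fps_expansion H"
    unfolding has_fps_expansion_def
    using r0 rad near by (auto simp: G_def ev elim!: eventually_mono)
  hence "deriv G has_fps_expansion fps_deriv H"
    by (rule has_fps_expansion_deriv)
  moreover have "(\<lambda>z. deriv (eval_fps L) z * G z) has_fps_expansion fps_deriv L * H"
    by (intro has_fps_expansion_mult has_fps_expansion_deriv L \<open>G has_fps_expansion H\<close>)
  moreover have "eventually (\<lambda>z. deriv G z = deriv (eval_fps L) z * G z) (nhds 0)"
    using near
  proof eventually_elim
    case (elim z)
    have "eval_fps L holomorphic_on eball 0 r"
      unfolding r_def by (intro holomorphic_intros) auto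
    hence "(eval_fps L has_field_derivative deriv (eval_fps L) z) (at z)"
      using elim by (intro holomorphic_derivI[of _ "eball 0 r"]) auto
    hence "(G has_field_derivative G z * deriv (eval_fps L) z) (at z)"
      unfolding G_def by (rule DERIV_fun_exp)
    thus ?case by (simp add: DERIV_imp_deriv mult.commute)
  qed
  ultimately have "deriv G has_fps_expansion fps_deriv H" "deriv G has_fps_expansion fps_deriv L * H"
    by (simp_all cong: has_fps_expansion_cong)
  hence "fps_deriv H = fps_deriv L * H"
    by (rule fps_expansion_unique_complex)
  moreover have "fps_nth H 0 = exp (fps_nth L 0)"
    using ev[of 0] r0 by (simp add: eval_fps_at_0 zero_ereal_def)
  ultimately show ?thesis using that[of H] rad ev by (simp add: r_def)
qed

lemma geometric_conv_radius:
  fixes L :: "complex fps"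
  assumes "0 < \<rho>" and "\<And>n. norm (fps_nth L n) \<le> C * \<rho> ^ n"
  shows "fps_conv_radius L \<ge> ereal (1 / \<rho>)"
  unfolding fps_conv_radius_def
proof (rule conv_radius_geI_ex)
  fix r :: real assume r: "0 < r" "ereal r < ereal (1 / \<rho>)"
  have "summable (\<lambda>n. C * (\<rho> * r) ^ n)"
    using r assms(1) by (intro summable_mult summable_geometric) (auto simp: field_simps)
  hence "summable (\<lambda>n. fps_nth L n * of_real r ^ n)"
  proof (rule summable_comparison_test')
    fix n show "norm (fps_nth L n * of_real r ^ n) \<le> C * (\<rho> * r) ^ n"
      using mult_right_mono[OF assms(2)[of n], of "r ^ n"] r
      by (simp add: norm_mult norm_power power_mult_distrib)
  qed
  thus "\<exists>z::complex. norm z = r \<and> summable (\<lambda>n. fps_nth L n * z ^ n)"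
    using r by (intro exI[of _ "of_real r"]) auto
qed

text \<open>
  The power series of \<open>(1 - t)\<^sup>-\<^sup>B\<close>, characterised up to a constant factor by the differential
  equation in the lemma that follows.
\<close>

definition neg_binomial_fps :: "complex \<Rightarrow> complex fps" where
  "neg_binomial_fps B = Abs_fps (\<lambda>m. pochhammer B m / fact m)"

lemma neg_binomial_fps_deriv: "(1 - fps_X) * fps_deriv (neg_binomial_fps B) = fps_const B * neg_binomial_fps B"
proof (rule fps_ext)
  fix n
  have rec: "of_nat (Suc n) * fps_nth (neg_binomial_fps B) (Suc n) = (B + of_nat n) * fps_nth (neg_binomial_fps B) n" for n
    unfolding neg_binomial_fps_def fps_nth_Abs_fps pochhammer_Suc fact_Suc
    by (simp add: mult.commute del: of_nat_Suc)
  have "fps_nth ((1 - fps_X) * fps_deriv (neg_binomial_fps B)) n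
      = of_nat (Suc n) * fps_nth (neg_binomial_fps B) (Suc n) - of_nat n * fps_nth (neg_binomial_fps B) n"
    by (cases n) (simp_all add: left_diff_distrib)
  also have "\<dots> = fps_nth (fps_const B * neg_binomial_fps B) n"
    unfolding rec by (simp add: ring_distribs)
  finally show "fps_nth ((1 - fps_X) * fps_deriv (neg_binomial_fps B)) n = fps_nth (fps_const B * neg_binomial_fps B) n" .
qed

text \<open>
  If the weights split as \<open>B + d(l)\<close>, then the solution of the recurrence is the coefficient sequence
  of \<open>H(t) (1 - t)\<^sup>-\<^sup>B\<close>, where \<open>H = exp (\<Sum>\<^sub>l d(l) t\<^sup>l / l)\<close> enters only through its differential
  equation. Both sequences solve the same recurrence and start with \<open>1\<close>.
\<close>

lemma convolution_factorization:
  fixes a d :: "nat \<Rightarrow> complex"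
  assumes a0: "a 0 = 1"
    and rec: "\<And>n. n > 0 \<Longrightarrow> of_nat n * a n = (\<Sum>l=1..n. (B + d l) * a (n - l))"
    and H0: "fps_nth H 0 = 1"
    and H: "fps_deriv H = Abs_fps (\<lambda>l. d (Suc l)) * H"
  shows "a n = (\<Sum>j\<le>n. fps_nth H j * (pochhammer B (n - j) / fact (n - j)))"
proof -
  define D where "D = Abs_fps (\<lambda>l. d (Suc l))"
  define C where "C = Abs_fps (\<lambda>l. B + d (Suc l))"
  define Q where "Q = H * neg_binomial_fps B"
  have "(1 - fps_X) * C = fps_const B + (1 - fps_X) * D"
  proof (rule fps_ext)
    fix n show "fps_nth ((1 - fps_X) * C) n = fps_nth (fps_const B + (1 - fps_X) * D) n"
      by (cases n) (auto simp: C_def D_def left_diff_distrib)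
  qed
  hence "(1 - fps_X) * (C * Q) = (fps_const B + (1 - fps_X) * D) * Q"
    by (simp add: mult.assoc[symmetric])
  also have "\<dots> = (1 - fps_X) * (D * H) * neg_binomial_fps B + H * (fps_const B * neg_binomial_fps B)"
    by (simp add: Q_def algebra_simps)
  also have "\<dots> = (1 - fps_X) * fps_deriv Q"
    unfolding neg_binomial_fps_deriv[symmetric] H[folded D_def, symmetric] Q_def by (simp add: algebra_simps)
  finally have QC: "fps_deriv Q = C * Q"
    using mult_left_cancel[of "1 - fps_X :: complex fps"] by force
  have "fps_nth Q 0 = 1" by (simp add: Q_def H0 neg_binomial_fps_def)
  have "fps_nth Q n = a n" for n
  proof (induction n rule: less_induct)
    case (less n)
    show ?case
    proof (cases n)
      case 0 thus ?thesis using \<open>fps_nth Q 0 = 1\<close> a0 by simp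
    next
      case (Suc m)
      have "of_nat n * fps_nth Q n = fps_nth (fps_deriv Q) m" by (simp add: Suc)
      also have "\<dots> = (\<Sum>i\<le>m. (B + d (Suc i)) * fps_nth Q (m - i))"
        unfolding QC by (simp add: fps_mult_nth C_def atLeast0AtMost)
      also have "\<dots> = (\<Sum>i\<le>m. (B + d (Suc i)) * a (m - i))"
        by (intro sum.cong) (auto simp: less Suc)
      also have "\<dots> = (\<Sum>l=1..n. (B + d l) * a (n - l))"
        unfolding Suc One_nat_def sum.shift_bounds_cl_Suc_ivl by (simp add: atLeast0AtMost)
      also have "\<dots> = of_nat n * a n" using rec[of n] Suc by simp
      finally show ?thesis using Suc by (simp del: of_nat_Suc)
    qed
  qed
  from this[of n, symmetric] show ?thesis
    by (simp add: Q_def fps_mult_nth neg_binomial_fps_def atLeast0AtMost)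
qed

text \<open>This is the product formula for the Gamma function, solved for the rising factorial.\<close>

lemma pochhammer_asymp:
  fixes B :: complex
  assumes "B \<notin> \<int>\<^sub>\<le>\<^sub>0"
  shows "(\<lambda>n. pochhammer B n / fact n) \<sim>[sequentially] (\<lambda>n. of_nat n powr (B - 1) / Gamma B)"
proof (rule asymp_equivI')
  have "(\<lambda>n. inverse (1 + B / of_nat n)) \<longlonglongrightarrow> inverse (1 + 0)"
    by (intro tendsto_intros lim_const_over_n) simp_all
  hence "(\<lambda>n. inverse (1 + B / of_nat n) * (Gamma B * rGamma_series B n)) \<longlonglongrightarrow> inverse (1 + 0) * (Gamma B * rGamma B)"
    by (intro tendsto_mult tendsto_const rGamma_series_LIMSEQ)
  also have "inverse (1 + 0) * (Gamma B * rGamma B) = 1"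
    using assms by (simp add: Gamma_eq_zero_iff rGamma_inverse_Gamma)
  finally show "(\<lambda>n. pochhammer B n / fact n / (of_nat n powr (B - 1) / Gamma B)) \<longlonglongrightarrow> 1"
  proof (rule Lim_transform_eventually)
    show "eventually (\<lambda>n. inverse (1 + B / of_nat n) * (Gamma B * rGamma_series B n) =
       pochhammer B n / fact n / (of_nat n powr (B - 1) / Gamma B)) sequentially"
      using eventually_gt_at_top[of 0]
    proof eventually_elim
      case (elim n)
      have nz: "B + of_nat n \<noteq> 0" using assms plus_of_nat_eq_0_imp[of B n] by blast
      have 1: "inverse (1 + B / of_nat n) = of_nat n / (B + of_nat n)"
        using elim by (simp add: field_simps)
      have 2: "of_nat n powr (B - 1) = exp (B * of_real (ln (real n))) / of_nat n"
        using elim by (simp add: powr_diff) (simp add: powr_def  flip: Ln_of_nat)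
      have *: "m / s * (G * (p * s / (F * E))) = p / F / (E / m / G)"
        if "s \<noteq> 0" for m s G p F E :: complex
        using that by (simp add: divide_simps)
      show ?case
        unfolding 1 2 rGamma_series_def Suc_eq_plus1[symmetric] pochhammer_Suc by (rule *[OF nz])
    qed
  qed
qed


text \<open>
  The two facts that allow passing to the limit in the convolution: \<open>p(n - k) / p(n)\<close> tends to \<open>1\<close>
  for fixed \<open>k\<close>, and for large \<open>n\<close> it is dominated by a geometric sequence in \<open>k\<close> whose ratio \<open>R\<close>
  may be any number greater than \<open>1\<close>. Both follow from \<open>p(n) / p(n + 1) \<longlonglongrightarrow> 1\<close>.
\<close>

lemma pochhammer_ratio_bound:
  fixes B :: complex
  assumes "B \<notin> \<int>\<^sub>\<le>\<^sub>0" and "R > 1"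
  defines "p \<equiv> \<lambda>n. pochhammer B n / fact n"
  shows "p n \<noteq> 0"
    and "(\<lambda>n. p (n - k) / p n) \<longlonglongrightarrow> 1"
    and "\<exists>C N. \<forall>n\<ge>N. \<forall>k\<le>n. norm (p (n - k) / p n) \<le> C * R ^ k"
proof -
  show nz: "p n \<noteq> 0" for n
    using assms(1) by (auto simp: p_def dest: pochhammer_eq_0_imp_nonpos_Int)
  have step: "(\<lambda>n. p n / p (Suc n)) \<longlonglongrightarrow> 1"
  proof -
    have "p n / p (Suc n) = 1 + (1 - B) / (B + of_nat n)" for n
    proof -
      have "B + of_nat n \<noteq> 0" using assms(1) plus_of_nat_eq_0_imp[of B n] by blast
      have "p (Suc n) = p n * ((B + of_nat n) / of_nat (Suc n))"
        by (simp add: p_def pochhammer_Suc field_simps)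
      hence "p n / p (Suc n) = of_nat (Suc n) / (B + of_nat n)"
        using nz[of n] by simp
      also have "\<dots> = 1 + (1 - B) / (B + of_nat n)"
        using \<open>B + of_nat n \<noteq> 0\<close> by (simp add: divide_simps)
      finally show ?thesis .
    qed
    moreover have "(\<lambda>n. 1 + (1 - B) / (B + of_nat n)) \<longlonglongrightarrow> 1 + 0"
      by (intro tendsto_add tendsto_const tendsto_divide_0[OF tendsto_const]
           tendsto_add_filterlim_at_infinity[OF tendsto_const tendsto_of_nat])
    ultimately show ?thesis by simp
  qed
  show "(\<lambda>n. p (n - k) / p n) \<longlonglongrightarrow> 1"
  proof (induction k)
    case 0 show ?case using nz by simp
  next
    case (Suc k)
    have "filterlim (\<lambda>n. n - Suc k) sequentially sequentially"
      by (rule filterlim_minus_const_nat_at_top)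
    hence "(\<lambda>n. p (n - Suc k) / p (Suc (n - Suc k))) \<longlonglongrightarrow> 1"
      by (rule filterlim_compose[OF step])
    hence "(\<lambda>n. p (n - Suc k) / p (Suc (n - Suc k)) * (p (n - k) / p n)) \<longlonglongrightarrow> 1 * 1"
      by (intro tendsto_mult Suc)
    hence "(\<lambda>n. p (n - Suc k) / p (Suc (n - Suc k)) * (p (n - k) / p n)) \<longlonglongrightarrow> 1"
      by simp
    thus ?case
    proof (rule Lim_transform_eventually)
      show "eventually (\<lambda>n. p (n - Suc k) / p (Suc (n - Suc k)) * (p (n - k) / p n)
        = p (n - Suc k) / p n) sequentially"
        using eventually_gt_at_top[of k]
        by eventually_elim (use nz in \<open>simp add: Suc_diff_Suc\<close>)
    qed
  qed
  have "(\<lambda>n. norm (p n / p (Suc n))) \<longlonglongrightarrow> norm (1::complex)"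
    by (intro tendsto_norm step)
  hence "eventually (\<lambda>n. norm (p n / p (Suc n)) < R) sequentially"
    using \<open>R > 1\<close> by (intro order_tendstoD) auto
  then obtain N where N: "\<And>n. n \<ge> N \<Longrightarrow> norm (p n / p (Suc n)) < R"
    by (auto simp: eventually_at_top_linorder)
  \<comment> \<open>By the choice of \<open>N\<close> the sequence \<open>v\<close> increases from \<open>N\<close> on; the finitely many earlier values
      are absorbed into the constant \<open>C\<close>.\<close>
  define v where "v n = norm (p n) * R ^ n" for n
  have v_pos: "v n > 0" for n using nz \<open>R > 1\<close> by (simp add: v_def)
  have v_mono: "v m \<le> v n" if "N \<le> m" "m \<le> n" for m n
    using that(2,1)
  proof (induction rule: dec_induct)
    case (step n)
    have "norm (p n) \<le> R * norm (p (Suc n))"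
      using N[of n] step nz[of "Suc n"] by (simp add: norm_divide field_simps)
    hence "v n \<le> v (Suc n)"
      using \<open>R > 1\<close> mult_right_mono[of "norm (p n)" "R * norm (p (Suc n))" "R ^ n"]
      by (simp add: v_def mult_ac)
    with step show ?case by simp
  qed simp
  define C where "C = 1 + (\<Sum>i\<le>N. v i) / v N"
  have "C \<ge> 1"
    unfolding C_def using v_pos by (simp add: sum_nonneg less_imp_le)
  have C: "v m \<le> C * v n" if "N \<le> n" "m \<le> n" for m n
  proof (cases "N \<le> m")
    case True
    have "v m \<le> 1 * v n" using v_mono True that by simp
    also have "1 * v n \<le> C * v n"
      using v_pos[of n] \<open>C \<ge> 1\<close> by (intro mult_right_mono) auto
    finally show ?thesis .
  next
    case False
    have "v m \<le> (\<Sum>i\<le>N. v i)"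
      using False v_pos by (intro member_le_sum) (auto intro: less_imp_le)
    also have "\<dots> \<le> C * v N" using v_pos[of N] by (simp add: C_def field_simps)
    also have "\<dots> \<le> C * v n"
      using v_mono[OF order.refl that(1)] \<open>C \<ge> 1\<close> by (intro mult_left_mono) auto
    finally show ?thesis .
  qed
  show "\<exists>C N. \<forall>n\<ge>N. \<forall>k\<le>n. norm (p (n - k) / p n) \<le> C * R ^ k"
  proof (intro exI allI impI)
    fix n k assume "N \<le> n" "k \<le> n"
    have "norm (p (n - k)) * R ^ (n - k) \<le> C * (norm (p n) * R ^ n)"
      using C[of n "n - k"] \<open>N \<le> n\<close> by (simp add: v_def)
    also have "R ^ n = R ^ k * R ^ (n - k)"
      using \<open>k \<le> n\<close> by (simp flip: power_add)
    finally have "norm (p (n - k)) * R ^ (n - k) \<le> (C * norm (p n) * R ^ k) * R ^ (n - k)"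
      by (simp add: mult_ac)
    hence "norm (p (n - k)) \<le> C * norm (p n) * R ^ k"
      using \<open>R > 1\<close> by simp
    thus "norm (p (n - k) / p n) \<le> C * R ^ k"
      using nz[of n] by (simp add: norm_divide field_simps)
  qed
qed

lemma convolution_asymp:
  fixes h :: "nat \<Rightarrow> complex"
  assumes "R > 1" and sum: "summable (\<lambda>n. norm (h n) * R ^ n)"
    and a: "\<And>n. a n = (\<Sum>j\<le>n. h j * (pochhammer B (n - j) / fact (n - j)))"
    and B: "B \<notin> \<int>\<^sub>\<le>\<^sub>0"
  shows "(\<lambda>n. a n / (pochhammer B n / fact n)) \<longlonglongrightarrow> (\<Sum>n. h n)"
proof -
  define p where "p n = pochhammer B n / fact n" for n
  define q where "q k n = (if k \<le> n then h k * (p (n - k) / p n) else 0)" for k n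
  note ratio = pochhammer_ratio_bound[OF B \<open>R > 1\<close>, folded p_def]
  obtain C N where CN: "\<And>n k. N \<le> n \<Longrightarrow> k \<le> n \<Longrightarrow> norm (p (n - k) / p n) \<le> C * R ^ k"
    using ratio(3) by blast
  have "C \<ge> 0" using CN[of N 0] by (metis norm_ge_zero order_trans mult.right_neutral power_0 order.refl le0)
  have "(\<lambda>n. suminf (\<lambda>k. q k n)) \<longlonglongrightarrow> suminf h"
  proof (rule tannerys_theorem[THEN conjunct2, THEN conjunct2])
    show "q k \<longlonglongrightarrow> h k" for k
    proof (rule Lim_transform_eventually)
      show "(\<lambda>n. h k * (p (n - k) / p n)) \<longlonglongrightarrow> h k"
        using tendsto_mult[OF tendsto_const ratio(2), of "h k" k] by simp
      show "eventually (\<lambda>n. h k * (p (n - k) / p n) = q k n) sequentially"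
        using eventually_ge_at_top[of k] by eventually_elim (simp add: q_def)
    qed
    show "eventually (\<lambda>(k, n). norm (q k n) \<le> C * (norm (h k) * R ^ k)) (at_top \<times>\<^sub>F sequentially)"
    proof -
      have "norm (q k n) \<le> C * (norm (h k) * R ^ k)" if "N \<le> n" for k n
        using mult_left_mono[OF CN[OF that, of k], of "norm (h k)"] \<open>C \<ge> 0\<close> \<open>R > 1\<close>
        by (auto simp: q_def norm_mult mult_ac simp del: times_divide_eq_right)
      thus ?thesis
        unfolding eventually_prod_filter
        by (intro exI[of _ "\<lambda>_. True"] exI[of _ "\<lambda>n. n \<ge> N"])
           (auto intro: eventually_ge_at_top)
    qed
    show "summable (\<lambda>k. C * (norm (h k) * R ^ k))"
      by (intro summable_mult sum)
  qed simp
  also have "(\<lambda>n. suminf (\<lambda>k. q k n)) = (\<lambda>n. a n / p n)"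
  proof
    fix n
    have "suminf (\<lambda>k. q k n) = (\<Sum>k\<le>n. q k n)"
      by (rule suminf_finite) (auto simp: q_def)
    also have "\<dots> = a n / p n"
      unfolding a p_def[symmetric] sum_divide_distrib by (intro sum.cong) (auto simp: q_def)
    finally show "suminf (\<lambda>k. q k n) = a n / p n" .
  qed
  finally show ?thesis by (simp add: p_def)
qed

lemma convolution_exponentially_small:
  fixes h :: "nat \<Rightarrow> complex"
  assumes "R > 1" and sum: "summable (\<lambda>n. norm (h n) * R ^ n)"
    and a: "\<And>n. a n = (\<Sum>j\<le>n. h j * (pochhammer B (n - j) / fact (n - j)))"
    and B: "B \<in> \<int>\<^sub>\<le>\<^sub>0"
  shows "a \<in> O(\<lambda>n. of_real (1 / R ^ n))"
proof -
  define p where "p n = pochhammer B n / fact n" for n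
  define K where "K = (\<Sum>n. norm (h n) * R ^ n)"
  obtain N where N: "B = - of_nat N" using B by (auto elim: nonpos_Ints_cases')
  have p0: "p n = 0" if "n > N" for n
    using that by (simp add: p_def N pochhammer_of_nat_eq_0_lemma)
  have K: "norm (h j) * R ^ j \<le> K" for j
    using sum_le_suminf[OF sum, of "{j}"] \<open>R > 1\<close> by (simp add: K_def)
  have "K \<ge> 0" using K[of 0] by (meson norm_ge_zero order_trans mult_nonneg_nonneg zero_le_power \<open>R > 1\<close> less_imp_le zero_le_one)
  show ?thesis
  proof (rule bigoI[of _ "K * (\<Sum>m\<le>N. norm (p m) * R ^ m)"], intro always_eventually allI)
    fix n
    have "norm (a n) * R ^ n \<le> (\<Sum>j\<le>n. norm (h j * p (n - j)) * R ^ n)"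
      unfolding a p_def[symmetric] sum_distrib_right[symmetric]
      using \<open>R > 1\<close> by (intro mult_right_mono norm_sum) auto
    also have "\<dots> = (\<Sum>j\<le>n. norm (h j) * R ^ j * (norm (p (n - j)) * R ^ (n - j)))"
    proof (intro sum.cong refl)
      fix j assume "j \<in> {..n}"
      hence "R ^ n = R ^ j * R ^ (n - j)" by (simp flip: power_add)
      thus "norm (h j * p (n - j)) * R ^ n = norm (h j) * R ^ j * (norm (p (n - j)) * R ^ (n - j))"
        by (simp add: norm_mult mult_ac)
    qed
    also have "\<dots> \<le> (\<Sum>j\<le>n. K * (norm (p (n - j)) * R ^ (n - j)))"
      using K \<open>R > 1\<close> by (intro sum_mono mult_right_mono) auto
    also have "\<dots> = K * (\<Sum>m\<le>n. norm (p m) * R ^ m)"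
      unfolding sum_distrib_left[symmetric] 
      by (intro arg_cong[of _ _ "(*) K"] sum.reindex_bij_witness[of _ "\<lambda>m. n - m" "\<lambda>j. n - j"]) auto
    also have "\<dots> \<le> K * (\<Sum>m\<le>N. norm (p m) * R ^ m)"
    proof (intro mult_left_mono \<open>K \<ge> 0\<close>)
      have "(\<Sum>m\<le>n. norm (p m) * R ^ m) = (\<Sum>m\<in>{..n} \<inter> {..N}. norm (p m) * R ^ m)"
        using p0 by (intro sum.mono_neutral_right) auto
      also have "\<dots> \<le> (\<Sum>m\<le>N. norm (p m) * R ^ m)"
        using \<open>R > 1\<close> by (intro sum_mono2) auto
      finally show "(\<Sum>m\<le>n. norm (p m) * R ^ m) \<le> (\<Sum>m\<le>N. norm (p m) * R ^ m)" .
    qed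
    finally show "norm (a n) \<le> K * (\<Sum>m\<le>N. norm (p m) * R ^ m) * norm (complex_of_real (1 / R ^ n))"
      using \<open>R > 1\<close> by (simp add: field_simps norm_divide norm_power)
  qed
qed

lemma recurrence_asymptotics:
  fixes a d :: "nat \<Rightarrow> complex"
  assumes rho: "0 < \<rho>" "\<rho> < 1"
    and d: "\<And>l. l > 0 \<Longrightarrow> norm (d l) \<le> K * \<rho> ^ l"
    and a0: "a 0 = 1"
    and rec: "\<And>n. n > 0 \<Longrightarrow> of_nat n * a n = (\<Sum>l=1..n. (B + d l) * a (n - l))"
  shows "B \<notin> \<int>\<^sub>\<le>\<^sub>0 \<Longrightarrow> a \<sim>[sequentially] 
            (\<lambda>n. of_nat n powr (B - 1) / Gamma B * exp (\<Sum>l. d l / of_nat l))"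
    and "B \<in> \<int>\<^sub>\<le>\<^sub>0 \<Longrightarrow> 1 < R \<Longrightarrow> R < 1 / \<rho> \<Longrightarrow> a \<in> O(\<lambda>n. of_real (1 / R ^ n))"
proof -
  define L where "L = Abs_fps (\<lambda>l. d l / of_nat l)"
  have "K * \<rho> \<ge> 0" using order_trans[OF norm_ge_zero d[of 1]] by simp
  hence "K \<ge> 0" using rho by (simp add: zero_le_mult_iff)
  have "norm (fps_nth L n) \<le> K * \<rho> ^ n" for n
  proof (cases "n = 0")
    case True thus ?thesis using \<open>K \<ge> 0\<close> by (simp add: L_def)
  next
    case False
    hence "norm (d n) / real n \<le> norm (d n) / 1" by (intro divide_left_mono) auto
    thus ?thesis using d[of n] False by (simp add: L_def norm_divide)
  qed
  hence rad: "fps_conv_radius L \<ge> ereal (1 / \<rho>)"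
    by (rule geometric_conv_radius[OF rho(1)])
  have "0 < ereal (1 / \<rho>)" using rho by simp
  with rad have "fps_conv_radius L > 0" by (meson order.strict_trans2)
  then obtain H where H0: "fps_nth H 0 = exp (fps_nth L 0)" and H: "fps_deriv H = fps_deriv L * H"
    and radH: "fps_conv_radius H \<ge> fps_conv_radius L"
    and ev: "\<And>z. ereal (norm z) < fps_conv_radius L \<Longrightarrow> eval_fps H z = exp (eval_fps L z)"
    using exp_power_series[of L] by metis
  have "fps_deriv L = Abs_fps (\<lambda>l. d (Suc l))"
    by (auto simp: fps_eq_iff L_def simp del: of_nat_Suc)
  with H have H': "fps_deriv H = Abs_fps (\<lambda>l. d (Suc l)) * H" by simp
  have H1: "fps_nth H 0 = 1" by (simp add: H0 L_def)
  have conv: "a n = (\<Sum>j\<le>n. fps_nth H j * (pochhammer B (n - j) / fact (n - j)))" for n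
    using a0 rec H1 H' by (rule convolution_factorization)
  have sum: "summable (\<lambda>n. norm (fps_nth H n) * R ^ n)" if R: "1 < R" "R < 1 / \<rho>" for R
  proof -
    have "ereal (norm (of_real R :: complex)) < ereal (1 / \<rho>)" using R by simp
    also have "\<dots> \<le> fps_conv_radius H" using rad radH by (rule order.trans)
    finally have "summable (\<lambda>n. norm (fps_nth H n * of_real R ^ n))"
      unfolding fps_conv_radius_def by (rule abs_summable_in_conv_radius)
    thus ?thesis using R by (simp add: norm_mult norm_power)
  qed
  show "a \<in> O(\<lambda>n. of_real (1 / R ^ n))" if "B \<in> \<int>\<^sub>\<le>\<^sub>0" "1 < R" "R < 1 / \<rho>"
    by (rule convolution_exponentially_small[OF that(2) sum[OF that(2,3)] conv that(1)])
  assume B: "B \<notin> \<int>\<^sub>\<le>\<^sub>0"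
  \<comment> \<open>The domination in the limit theorem uses a ratio \<open>R > 1\<close> that still lies inside the disc of
      convergence of \<open>H\<close>.\<close>
  obtain R where R: "1 < R" "R < 1 / \<rho>"
    using dense[of 1 "1 / \<rho>"] rho by auto
  have "ereal (norm (1 :: complex)) < ereal (1 / \<rho>)" using rho by simp
  also have "\<dots> \<le> fps_conv_radius L" by (rule rad)
  finally have ev1: "eval_fps H 1 = exp (eval_fps L 1)" by (rule ev)
  define S where "S = (\<Sum>l. d l / of_nat l)"
  have lim: "(\<lambda>n. a n / (pochhammer B n / fact n)) \<longlonglongrightarrow> exp S"
    using convolution_asymp[OF R(1) sum[OF R] conv B] ev1
    by (simp add: eval_fps_def L_def S_def)
  have "(\<lambda>n. a n / (pochhammer B n / fact n * exp S)) \<longlonglongrightarrow> exp S / exp S"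
    using tendsto_divide[OF lim tendsto_const, of "exp S"] by (simp add: divide_divide_eq_left)
  hence "a \<sim>[sequentially] (\<lambda>n. pochhammer B n / fact n * exp S)"
    by (intro asymp_equivI') simp
  also have "\<dots> \<sim>[sequentially] (\<lambda>n. of_nat n powr (B - 1) / Gamma B * exp S)"
    by (intro asymp_equiv_intros pochhammer_asymp B)
  finally show "a \<sim>[sequentially] (\<lambda>n. of_nat n powr (B - 1) / Gamma B * exp (\<Sum>l. d l / of_nat l))"
    by (simp add: S_def)
qed

section \<open>The limit as an unconditional infinite product\<close>

lemma has_sum_Ln_one_minus:
  fixes w :: complex
  assumes "norm w < 1"
  shows "((\<lambda>l. w ^ Suc l / of_nat (Suc l)) has_sum - Ln (1 - w)) UNIV"
proof (rule norm_summable_imp_has_sum)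
  have "(\<lambda>n. - (w ^ n) / of_nat n) sums Ln (1 - w)"
    using Ln_series'[of "- w"] assms by simp
  hence "(\<lambda>n. - (w ^ Suc n) / of_nat (Suc n)) sums (Ln (1 - w) - - (w ^ 0) / of_nat 0)"
    by (subst sums_Suc_iff) simp
  from sums_minus[OF this] show "(\<lambda>l. w ^ Suc l / of_nat (Suc l)) sums - Ln (1 - w)"
    by simp
  have "summable (\<lambda>l. norm w ^ Suc l)"
    using assms by (subst summable_Suc_iff) (simp add: summable_geometric)
  thus "summable (\<lambda>l. norm (w ^ Suc l / of_nat (Suc l)))"
  proof (rule summable_comparison_test')
    fix l :: nat
    show "norm (norm (w ^ Suc l / of_nat (Suc l))) \<le> norm w ^ Suc l"
      using divide_left_mono[of 1 "real (Suc l)" "norm w ^ Suc l"] 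
      by (simp add: norm_divide norm_power norm_mult del: of_nat_Suc)
  qed
qed

text \<open>
  The product is \<open>exp (\<Sum>\<^sub>k - \<beta>\<^sub>k log (1 - w\<^sub>k))\<close>. Expanding the logarithm gives a double sum dominated
  by \<open>\<bar>\<beta>\<^sub>k w\<^sub>k\<bar> \<rho>\<^sup>l\<close>, in which the order of summation may be exchanged. The other two conclusions are
  the convergence of the inner sums \<open>d(l)\<close> over \<open>k\<close> and their geometric decay.
\<close>

lemma has_unordered_prod_powr:
  fixes \<beta> w :: "'k \<Rightarrow> complex"
  assumes rho: "0 < \<rho>" "\<rho> < 1"
    and w: "\<And>k. k \<in> K \<Longrightarrow> norm (w k) \<le> \<rho>"
    and summable: "(\<lambda>k. norm (\<beta> k * w k)) summable_on K"
  defines "d \<equiv> \<lambda>l. \<Sum>\<^sub>\<infinity>k\<in>K. \<beta> k * w k ^ l"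
  shows "has_unordered_prod (\<lambda>k. (1 - w k) powr (- \<beta> k)) (exp (\<Sum>l. d l / of_nat l)) K"
    and "l > 0 \<Longrightarrow> ((\<lambda>k. \<beta> k * w k ^ l) has_sum d l) K"
    and "l > 0 \<Longrightarrow> norm (d l) \<le> (\<Sum>\<^sub>\<infinity>k\<in>K. norm (\<beta> k * w k)) / \<rho> * \<rho> ^ l"
proof -
  define N where "N k = norm (\<beta> k * w k)" for k
  note summable = summable[folded N_def]
  have bound: "norm (\<beta> k * w k ^ Suc l) \<le> N k * \<rho> ^ l" if "k \<in> K" for k l
  proof -
    have "norm (\<beta> k * w k ^ Suc l) = N k * norm (w k) ^ l"
      by (simp add: N_def norm_mult norm_power)
    also have "\<dots> \<le> N k * \<rho> ^ l"
      using w[OF that] by (intro mult_left_mono power_mono) (auto simp: N_def)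
    finally show ?thesis .
  qed
  have col_norm: "(\<lambda>k. norm (\<beta> k * w k ^ Suc l)) summable_on K" for l
    by (rule Infinite_Sum.abs_summable_on_comparison_test'[of "\<lambda>k. N k * \<rho> ^ l"])
       (use bound in \<open>auto intro: summable_on_cmult_left summable simp del: power_Suc\<close>)
  have col: "((\<lambda>k. \<beta> k * w k ^ Suc l) has_sum d (Suc l)) K" for l
    unfolding d_def by (rule has_sum_infsum[OF abs_summable_summable[OF col_norm]])
  show "((\<lambda>k. \<beta> k * w k ^ l) has_sum d l) K" if "l > 0" for l
    using col[of "l - 1"] that by simp
  have d_bound: "norm (d (Suc l)) \<le> infsum N K * \<rho> ^ l" for l
    using norm_infsum_le[OF col has_sum_cmult_left[OF has_sum_infsum[OF summable]] bound] .
  show "norm (d l) \<le> infsum (\<lambda>k. norm (\<beta> k * w k)) K / \<rho> * \<rho> ^ l" if "l > 0" for l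
    using d_bound[of "l - 1"] that rho by (cases l) (simp_all flip: N_def)
  \<comment> \<open>The second index \<open>l\<close> starts at \<open>0\<close> and stands for the exponent \<open>l + 1\<close>.\<close>
  define t where "t = (\<lambda>(k, l). \<beta> k * (w k ^ Suc l / of_nat (Suc l)))"
  have t_bound: "norm (t (k, l)) \<le> N k * \<rho> ^ l" if "k \<in> K" for k l
  proof -
    have "norm (t (k, l)) = norm (\<beta> k * w k ^ Suc l) / real (Suc l)"
      by (simp add: t_def norm_mult norm_divide norm_power del: of_nat_Suc)
    also have "\<dots> \<le> norm (\<beta> k * w k ^ Suc l) / 1" by (intro divide_left_mono) auto
    also have "\<dots> \<le> N k * \<rho> ^ l" using bound[OF that] by simp
    finally show ?thesis .
  qed
  have "(\<lambda>(k, l). N k * \<rho> ^ l) summable_on K \<times> UNIV"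
  proof (rule summable_on_SigmaI)
    have "((\<lambda>l. \<rho> ^ l) has_sum (1 / (1 - \<rho>))) UNIV"
      using rho by (intro sums_nonneg_imp_has_sum geometric_sums) auto
    thus "((\<lambda>l. case (k, l) of (k, l) \<Rightarrow> N k * \<rho> ^ l) has_sum N k * (1 / (1 - \<rho>))) UNIV" for k
      by (simp only: prod.case has_sum_cmult_right)
    show "(\<lambda>k. N k * (1 / (1 - \<rho>))) summable_on K"
      by (intro summable_on_cmult_left summable)
  qed (use rho in \<open>auto simp: N_def\<close>)
  hence "(\<lambda>p. norm (t p)) summable_on K \<times> UNIV"
    by (rule Infinite_Sum.abs_summable_on_comparison_test') (use t_bound in auto)
  hence "t summable_on K \<times> UNIV" by (rule abs_summable_summable)
  then obtain S where S: "(t has_sum S) (K \<times> UNIV)" by (auto simp: summable_on_def)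
  have rows: "((\<lambda>k. \<beta> k * - Ln (1 - w k)) has_sum S) K"
  proof (rule has_sum_SigmaD[OF S])
    fix k assume "k \<in> K"
    hence "norm (w k) < 1" using w rho by fastforce
    thus "((\<lambda>l. t (k, l)) has_sum \<beta> k * - Ln (1 - w k)) UNIV"
      unfolding t_def prod.case by (intro has_sum_cmult_right has_sum_Ln_one_minus)
  qed
  have cols: "((\<lambda>l. d (Suc l) / of_nat (Suc l)) has_sum S) UNIV"
  proof (rule has_sum_SigmaD[where f = "\<lambda>(l, k). t (k, l)" and B = "\<lambda>_. K"])
    show "((\<lambda>(l, k). t (k, l)) has_sum S) (UNIV \<times> K)"
      using S has_sum_swap by blast
    show "((\<lambda>k. case (l, k) of (l, k) \<Rightarrow> t (k, l)) has_sum d (Suc l) / of_nat (Suc l)) K" for l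
      using has_sum_divide_const[OF col, of l "of_nat (Suc l)"] by (simp add: t_def)
  qed
  have "(\<lambda>l. d l / of_nat l) sums S"
    using has_sum_imp_sums[OF cols] by (subst (asm) sums_Suc_iff) simp
  hence S_eq: "S = (\<Sum>l. d l / of_nat l)" by (rule sums_unique)
  \<comment> \<open>Taking exponentials turns finite sums of logarithms into finite products, and the limit is
      nonzero because it is an exponential.\<close>
  have "((\<lambda>X. exp (\<Sum>k\<in>X. \<beta> k * - Ln (1 - w k))) \<longlongrightarrow> exp S) (finite_subsets_at_top K)"
    using rows unfolding has_sum_def by (rule tendsto_exp)
  moreover have "eventually (\<lambda>X. exp (\<Sum>k\<in>X. \<beta> k * - Ln (1 - w k)) = (\<Prod>k\<in>X. (1 - w k) powr (- \<beta> k)))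
      (finite_subsets_at_top K)"
  proof (rule eventually_finite_subsets_at_top_weakI)
    fix X assume X: "finite X" "X \<subseteq> K"
    show "exp (\<Sum>k\<in>X. \<beta> k * - Ln (1 - w k)) = (\<Prod>k\<in>X. (1 - w k) powr (- \<beta> k))"
      unfolding exp_sum[OF X(1)]
    proof (intro prod.cong refl)
      fix k assume "k \<in> X"
      hence "norm (w k) < 1" using X w rho by fastforce
      hence "1 - w k \<noteq> 0" by auto
      thus "exp (\<beta> k * - Ln (1 - w k)) = (1 - w k) powr (- \<beta> k)" by (simp add: powr_def)
    qed
  qed
  ultimately have "((\<lambda>X. \<Prod>k\<in>X. (1 - w k) powr (- \<beta> k)) \<longlongrightarrow> exp S) (finite_subsets_at_top K)"
    by (rule Lim_transform_eventually)
  thus "has_unordered_prod (\<lambda>k. (1 - w k) powr (- \<beta> k)) (exp (\<Sum>l. d l / of_nat l)) K"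
    by (simp add: has_unordered_prod_def S_eq)
qed

section \<open>Expectation over the auxiliary variables\<close>

text \<open>
  Termwise integration of a double series with a summable constant majorant, reduced to ordinary
  series by enumerating the pairs of indices.
\<close>

lemma integral_has_sum:
  fixes g :: "nat \<times> nat \<Rightarrow> 'w \<Rightarrow> complex"
  assumes "finite_measure N"
    and meas: "\<And>k. g k \<in> borel_measurable N"
    and bound: "\<And>k \<omega>. \<omega> \<in> space N \<Longrightarrow> norm (g k \<omega>) \<le> C k"
    and C: "C summable_on UNIV"
    and F: "\<And>\<omega>. \<omega> \<in> space N \<Longrightarrow> ((\<lambda>k. g k \<omega>) has_sum F \<omega>) UNIV"
  shows "F \<in> borel_measurable N"
    and "((\<lambda>k. LINT \<omega>|N. g k \<omega>) has_sum (LINT \<omega>|N. F \<omega>)) UNIV"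
proof -
  interpret finite_measure N by fact
  note [measurable] = meas
  note reindex = has_sum_reindex_bij_betw[OF bij_prod_decode]
  have int: "integrable N (g k)" for k
    by (rule integrable_const_bound[of _ "C k"]) (auto intro: bound)
  have c: "summable (\<lambda>n. C (prod_decode n))"
    using C summable_on_reindex_bij_betw[OF bij_prod_decode, of C]
    by (auto intro: summable_on_imp_summable)
  have sums: "(\<lambda>n. g (prod_decode n) \<omega>) sums F \<omega>" if "\<omega> \<in> space N" for \<omega>
    using F[OF that] by (subst (asm) reindex[symmetric]) (rule has_sum_imp_sums)
  show "F \<in> borel_measurable N"
  proof (rule borel_measurable_LIMSEQ_metric)
    show "(\<lambda>\<omega>. \<Sum>i<n. g (prod_decode i) \<omega>) \<in> borel_measurable N" for n by measurable
    show "(\<lambda>n. \<Sum>i<n. g (prod_decode i) \<omega>) \<longlonglongrightarrow> F \<omega>" if "\<omega> \<in> space N" for \<omega>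
      using sums[OF that] by (simp add: sums_def)
  qed
  have norm_int: "(LINT \<omega>|N. norm (g k \<omega>)) \<le> C k * measure N (space N)" for k
  proof -
    have "(LINT \<omega>|N. norm (g k \<omega>)) \<le> (LINT \<omega>|N. C k)"
      using int bound by (intro integral_mono) auto
    thus ?thesis by (simp add: mult.commute)
  qed
  have sum_int: "summable (\<lambda>n. LINT \<omega>|N. norm (g (prod_decode n) \<omega>))"
    by (rule summable_comparison_test'[OF summable_mult2[OF c]]) (use norm_int in simp)
  have "(\<lambda>n. LINT \<omega>|N. g (prod_decode n) \<omega>) sums (LINT \<omega>|N. (\<Sum>n. g (prod_decode n) \<omega>))"
  proof (rule sums_integral[OF int _ sum_int])
    show "AE \<omega> in N. summable (\<lambda>n. norm (g (prod_decode n) \<omega>))"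
      by (intro AE_I2 summable_comparison_test'[OF c]) (use bound in auto)
  qed
  also have "(LINT \<omega>|N. (\<Sum>n. g (prod_decode n) \<omega>)) = (LINT \<omega>|N. F \<omega>)"
    by (intro Bochner_Integration.integral_cong) (use sums in \<open>auto simp: sums_iff\<close>)
  finally have "(\<lambda>n. LINT \<omega>|N. g (prod_decode n) \<omega>) sums (LINT \<omega>|N. F \<omega>)" .
  moreover have "summable (\<lambda>n. norm (LINT \<omega>|N. g (prod_decode n) \<omega>))"
    by (rule summable_comparison_test'[OF sum_int]) (auto intro: integral_norm_bound)
  ultimately have "((\<lambda>n. LINT \<omega>|N. g (prod_decode n) \<omega>) has_sum (LINT \<omega>|N. F \<omega>)) UNIV"
    by (intro norm_summable_imp_has_sum)
  thus "((\<lambda>k. LINT \<omega>|N. g k \<omega>) has_sum (LINT \<omega>|N. F \<omega>)) UNIV"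
    by (subst (asm) reindex)
qed

lemma indep_vars_coordinates:
  assumes "prob_space M" "I \<noteq> {}"
  shows "prob_space.indep_vars (PiM I (\<lambda>_. M)) (\<lambda>_. M) (\<lambda>i \<omega>. \<omega> i) I"
proof -
  let ?N = "PiM I (\<lambda>_. M)"
  interpret prob_space ?N by (intro prob_space_PiM assms(1))
  have "distr ?N ?N (\<lambda>\<omega>. \<lambda>i\<in>I. \<omega> i) = distr ?N ?N (\<lambda>\<omega>. \<omega>)"
    by (intro distr_cong refl) (auto simp: space_PiM PiE_restrict)
  also have "\<dots> = ?N" by (rule distr_id)
  also have "?N = (\<Pi>\<^sub>M i\<in>I. distr ?N M (\<lambda>\<omega>. \<omega> i))"
    by (intro PiM_cong refl distr_PiM_component[symmetric] assms(1))
  finally show ?thesis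
    by (subst indep_vars_iff_distr_eq_PiM'[OF assms(2)]) auto
qed

lemma borel_measurable_coordinate:
  assumes "i \<in> I" "h \<in> borel_measurable M"
  shows "(\<lambda>\<omega>. h (\<omega> i)) \<in> borel_measurable (PiM I (\<lambda>_. M))"
  using measurable_component_singleton[OF assms(1), of "\<lambda>_. M"] assms(2) by (rule measurable_compose)

lemma integral_PiM_component:
  fixes h :: "'w \<Rightarrow> complex"
  assumes "prob_space M" "i \<in> I" "h \<in> borel_measurable M"
  shows "(LINT \<omega>|PiM I (\<lambda>_. M). h (\<omega> i)) = (LINT \<omega>|M. h \<omega>)"
proof -
  have "(LINT \<omega>|M. h \<omega>) = (LINT \<omega>|distr (PiM I (\<lambda>_. M)) M (\<lambda>\<omega>. \<omega> i). h \<omega>)"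
    using assms by (subst distr_PiM_component) auto
  also have "\<dots> = (LINT \<omega>|PiM I (\<lambda>_. M). h (\<omega> i))"
    using assms by (intro integral_distr) auto
  finally show ?thesis by simp
qed

lemma integral_PiM_prod_coordinates:
  fixes h :: "'w \<Rightarrow> complex"
  assumes M: "prob_space M" and J: "finite J" "J \<subseteq> I"
    and h: "h \<in> borel_measurable M" "\<And>\<omega>. \<omega> \<in> space M \<Longrightarrow> norm (h \<omega>) \<le> C"
  shows "(LINT \<omega>|PiM I (\<lambda>_. M). (\<Prod>j\<in>J. h (\<omega> j))) = (LINT \<omega>|M. h \<omega>) ^ card J"
proof -
  let ?N = "PiM I (\<lambda>_. M)"
  interpret N: prob_space ?N by (intro prob_space_PiM M)
  show ?thesis
  proof (cases "J = {}")
    case False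
    have [measurable]: "(\<lambda>\<omega>. h (\<omega> j)) \<in> borel_measurable ?N" if "j \<in> J" for j
      using that J(2) h(1) by (intro borel_measurable_coordinate) auto
    have "N.indep_vars (\<lambda>_. M) (\<lambda>i \<omega>. \<omega> i) J"
      using J(2) False by (intro N.indep_vars_subset[OF indep_vars_coordinates[OF M] J(2)]) auto
    hence "N.indep_vars (\<lambda>_. borel) (\<lambda>j \<omega>. h (\<omega> j)) J"
      using h(1) by (rule N.indep_vars_compose2)
    moreover have "integrable ?N (\<lambda>\<omega>. h (\<omega> j))" if "j \<in> J" for j
      using that J(2) by (intro N.integrable_const_bound[of _ C]) 
        (auto intro!: h(2) AE_I2 simp: space_PiM PiE_iff)
    ultimately have "(LINT \<omega>|?N. (\<Prod>j\<in>J. h (\<omega> j))) = (\<Prod>j\<in>J. LINT \<omega>|?N. h (\<omega> j))"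
      using J(1) by (intro N.indep_vars_lebesgue_integral) auto
    also have "\<dots> = (\<Prod>j\<in>J. LINT \<omega>|M. h \<omega>)"
      using J(2) h(1) by (intro prod.cong refl integral_PiM_component M) auto
    finally show ?thesis by simp
  qed (simp add: N.prob_space)
qed

text \<open>
  A power series that converges on the closed polydisc with radii \<open>\<bar>x\<^sub>1\<bar>, \<bar>x\<^sub>2\<bar> < 1\<close>, and a pair of
  random variables on the unit circle with joint moments \<open>\<alpha>\<close>. Multiplication of the arguments by
  values on the circle and passing to powers \<open>x\<^sub>1\<^sup>l, x\<^sub>2\<^sup>l\<close> with \<open>l \<ge> 1\<close> stay inside this polydisc.
\<close>

locale random_torus_series =
  fixes f :: "complex \<times> complex \<Rightarrow> complex" and b :: "nat \<Rightarrow> nat \<Rightarrow> complex"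
    and M :: "'w measure" and \<theta> \<eta> :: "'w \<Rightarrow> complex" and \<alpha> :: "nat \<Rightarrow> nat \<Rightarrow> complex"
    and x1 x2 :: complex
  assumes series: "\<And>z1 z2. norm z1 \<le> norm x1 \<Longrightarrow> norm z2 \<le> norm x2 \<Longrightarrow>
           ((\<lambda>(k1, k2). b k1 k2 * z1 ^ k1 * z2 ^ k2) has_sum f (z1, z2)) UNIV"
    and prob: "prob_space M"
    and meas [measurable]: "\<theta> \<in> borel_measurable M" "\<eta> \<in> borel_measurable M"
    and norm_theta: "\<And>\<omega>. \<omega> \<in> space M \<Longrightarrow> norm (\<theta> \<omega>) = 1"
    and norm_eta: "\<And>\<omega>. \<omega> \<in> space M \<Longrightarrow> norm (\<eta> \<omega>) = 1"
    and alpha: "\<And>k1 k2. \<alpha> k1 k2 = (LINT \<omega>|M. \<theta> \<omega> ^ k1 * \<eta> \<omega> ^ k2)"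
    and x_less: "norm x1 < 1" "norm x2 < 1"
begin

text \<open>The absolute values of the terms of the series at the point \<open>(x\<^sub>1, x\<^sub>2)\<close>.\<close>

definition majorant :: "nat \<times> nat \<Rightarrow> real" where
  "majorant = (\<lambda>(k1, k2). norm (b k1 k2) * norm x1 ^ k1 * norm x2 ^ k2)"

lemma majorant_nonneg: "majorant k \<ge> 0"
  by (simp add: majorant_def case_prod_unfold)

lemma majorant_summable: "majorant summable_on UNIV"
proof -
  have "(\<lambda>(k1, k2). b k1 k2 * x1 ^ k1 * x2 ^ k2) summable_on UNIV"
    using series[of x1 x2] by (auto simp: summable_on_def)
  hence "(\<lambda>k. norm (case k of (k1, k2) \<Rightarrow> b k1 k2 * x1 ^ k1 * x2 ^ k2)) summable_on UNIV"
    by (simp add: summable_on_iff_abs_summable_on_complex)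
  also have "(\<lambda>k. norm (case k of (k1, k2) \<Rightarrow> b k1 k2 * x1 ^ k1 * x2 ^ k2)) = majorant"
    by (auto simp: majorant_def norm_mult norm_power)
  finally show ?thesis .
qed

lemma term_bound:
  assumes "norm z1 \<le> norm x1" "norm z2 \<le> norm x2"
  shows "norm (b k1 k2 * z1 ^ k1 * z2 ^ k2) \<le> majorant (k1, k2)"
  using assms unfolding majorant_def prod.case norm_mult norm_power
  by (intro mult_mono power_mono mult_nonneg_nonneg) auto

lemma norm_f_bound:
  assumes "norm z1 \<le> norm x1" "norm z2 \<le> norm x2"
  shows "norm (f (z1, z2)) \<le> infsum majorant UNIV"
  using norm_infsum_le[OF series[OF assms] has_sum_infsum[OF majorant_summable]] term_bound[OF assms]
  by auto

lemma norm_alpha: "norm (\<alpha> k1 k2) \<le> 1"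
proof -
  interpret prob_space M by (rule prob)
  have "norm (\<alpha> k1 k2) \<le> (LINT \<omega>|M. norm (\<theta> \<omega> ^ k1 * \<eta> \<omega> ^ k2))"
    unfolding alpha by (rule integral_norm_bound)
  also have "\<dots> = (LINT \<omega>|M. 1)"
    by (intro Bochner_Integration.integral_cong) (auto simp: norm_mult norm_power norm_theta norm_eta)
  finally show ?thesis by (simp add: prob_space)
qed

lemma alpha_00 [simp]: "\<alpha> 0 0 = 1"
proof -
  interpret prob_space M by (rule prob)
  show ?thesis by (simp add: alpha prob_space)
qed

text \<open>
  The factor that a single cycle contributes: \<open>J\<close> is the set of indices of the auxiliary pairs that
  belong to the cycle, a single index for \<open>W\<^sup>1\<close> and one index per point of the cycle for \<open>W\<^sup>2\<close>.
\<close>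

definition block :: "complex \<Rightarrow> complex \<Rightarrow> 'i set \<Rightarrow> ('i \<Rightarrow> 'w) \<Rightarrow> complex" where
  "block y1 y2 J \<omega> = f (y1 * (\<Prod>j\<in>J. \<theta> (\<omega> j)), y2 * (\<Prod>j\<in>J. \<eta> (\<omega> j)))"

text \<open>
  The term of index \<open>(k\<^sub>1, k\<^sub>2)\<close> contains the product over \<open>J\<close> of independent copies of
  \<open>\<theta>\<^sup>k\<^sup>1 \<eta>\<^sup>k\<^sup>2\<close>, and so contributes one factor \<open>\<alpha> k1 k2\<close> per element of \<open>J\<close>.
\<close>

lemma
  assumes y: "norm y1 \<le> norm x1" "norm y2 \<le> norm x2" and J: "finite J" "J \<subseteq> I"
  shows block_measurable: "block y1 y2 J \<in> borel_measurable (PiM I (\<lambda>_. M))"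
    and block_expectation: "((\<lambda>(k1, k2). b k1 k2 * \<alpha> k1 k2 ^ card J * y1 ^ k1 * y2 ^ k2) has_sum
         (LINT \<omega>|PiM I (\<lambda>_. M). block y1 y2 J \<omega>)) UNIV"
    and block_bound: "\<And>\<omega>. \<omega> \<in> space (PiM I (\<lambda>_. M)) \<Longrightarrow> norm (block y1 y2 J \<omega>) \<le> infsum majorant UNIV"
proof -
  let ?N = "PiM I (\<lambda>_. M)"
  interpret N: prob_space ?N by (intro prob_space_PiM prob)
  define g where "g = (\<lambda>(k1, k2) \<omega>. b k1 k2 * (y1 * (\<Prod>j\<in>J. \<theta> (\<omega> j))) ^ k1 * (y2 * (\<Prod>j\<in>J. \<eta> (\<omega> j))) ^ k2)"
  have norms: "norm (y1 * (\<Prod>j\<in>J. \<theta> (\<omega> j))) \<le> norm x1" "norm (y2 * (\<Prod>j\<in>J. \<eta> (\<omega> j))) \<le> norm x2"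
    if "\<omega> \<in> space ?N" for \<omega>
  proof -
    have "\<omega> j \<in> space M" if "j \<in> J" for j
      using that \<open>\<omega> \<in> space ?N\<close> J(2) by (auto simp: space_PiM)
    hence "(\<Prod>j\<in>J. norm (\<theta> (\<omega> j))) = 1" "(\<Prod>j\<in>J. norm (\<eta> (\<omega> j))) = 1"
      by (simp_all add: norm_theta norm_eta)
    thus "norm (y1 * (\<Prod>j\<in>J. \<theta> (\<omega> j))) \<le> norm x1" "norm (y2 * (\<Prod>j\<in>J. \<eta> (\<omega> j))) \<le> norm x2"
      using y by (simp_all add: norm_mult prod_norm)
  qed
  show "norm (block y1 y2 J \<omega>) \<le> infsum majorant UNIV" if "\<omega> \<in> space ?N" for \<omega>
    unfolding block_def by (intro norm_f_bound norms that)
  have [measurable]: "(\<lambda>\<omega>. \<theta> (\<omega> j)) \<in> borel_measurable ?N" "(\<lambda>\<omega>. \<eta> (\<omega> j)) \<in> borel_measurable ?N"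
    if "j \<in> J" for j
    using that J(2) by (auto intro!: borel_measurable_coordinate meas)
  have g_meas: "g k \<in> borel_measurable ?N" for k
    unfolding g_def case_prod_unfold by measurable
  have g_bound: "norm (g k \<omega>) \<le> majorant k" if "\<omega> \<in> space ?N" for k \<omega>
    using term_bound[OF norms[OF that], of "fst k" "snd k"] by (simp add: g_def case_prod_unfold)
  have g_sum: "((\<lambda>k. g k \<omega>) has_sum block y1 y2 J \<omega>) UNIV" if "\<omega> \<in> space ?N" for \<omega>
    using series[OF norms[OF that]] by (simp add: g_def block_def case_prod_unfold)
  note swap = integral_has_sum[OF N.finite_measure_axioms g_meas g_bound majorant_summable g_sum]
  show "block y1 y2 J \<in> borel_measurable ?N" by (rule swap(1))
  have "(LINT \<omega>|?N. g k \<omega>) = (case k of (k1, k2) \<Rightarrow> b k1 k2 * \<alpha> k1 k2 ^ card J * y1 ^ k1 * y2 ^ k2)" for k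
  proof (cases k)
    case (Pair k1 k2)
    have "(LINT \<omega>|?N. g k \<omega>) = (LINT \<omega>|?N. (b k1 k2 * y1 ^ k1 * y2 ^ k2) * (\<Prod>j\<in>J. \<theta> (\<omega> j) ^ k1 * \<eta> (\<omega> j) ^ k2))"
      by (simp add: Pair g_def power_mult_distrib prod.distrib prod_power_distrib mult_ac)
    also have "\<dots> = (b k1 k2 * y1 ^ k1 * y2 ^ k2) * (LINT \<omega>|?N. (\<Prod>j\<in>J. \<theta> (\<omega> j) ^ k1 * \<eta> (\<omega> j) ^ k2))"
      by (rule integral_mult_right_zero)
    also have "(LINT \<omega>|?N. (\<Prod>j\<in>J. \<theta> (\<omega> j) ^ k1 * \<eta> (\<omega> j) ^ k2)) = \<alpha> k1 k2 ^ card J"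
      unfolding alpha
      by (rule integral_PiM_prod_coordinates[OF prob J, of _ 1])
         (auto simp: norm_mult norm_power norm_theta norm_eta)
    finally show ?thesis by (simp add: Pair mult_ac)
  qed
  with swap(2) show "((\<lambda>(k1, k2). b k1 k2 * \<alpha> k1 k2 ^ card J * y1 ^ k1 * y2 ^ k2) has_sum
         (LINT \<omega>|?N. block y1 y2 J \<omega>)) UNIV"
    by simp
qed

lemma prod_block_expectation:
  fixes J :: "nat \<Rightarrow> 'i set" and y1 y2 :: "nat \<Rightarrow> complex"
  assumes y: "\<And>m. m < L \<Longrightarrow> norm (y1 m) \<le> norm x1" "\<And>m. m < L \<Longrightarrow> norm (y2 m) \<le> norm x2"
    and J: "\<And>m. m < L \<Longrightarrow> finite (J m)" "disjoint_family_on J {..<L}"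
  shows "(LINT \<omega>|PiM UNIV (\<lambda>_. M). (\<Prod>m<L. block (y1 m) (y2 m) (J m) \<omega>)) =
    (\<Prod>m<L. \<Sum>\<^sub>\<infinity>(k1, k2). b k1 k2 * \<alpha> k1 k2 ^ card (J m) * y1 m ^ k1 * y2 m ^ k2)"
proof -
  let ?N = "PiM UNIV (\<lambda>_::'i. M)"
  interpret N: prob_space ?N by (intro prob_space_PiM prob)
  have "N.indep_vars (\<lambda>m. PiM (J m) (\<lambda>_. M)) (\<lambda>m \<omega>. restrict (\<lambda>i. \<omega> i) (J m)) {..<L}"
    by (intro N.indep_vars_restrict[OF indep_vars_coordinates[OF prob]] J) auto
  hence "N.indep_vars (\<lambda>_. borel) (\<lambda>m \<omega>. block (y1 m) (y2 m) (J m) (restrict (\<lambda>i. \<omega> i) (J m))) {..<L}"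
    by (rule N.indep_vars_compose2) (use y J(1) in \<open>auto intro!: block_measurable\<close>)
  \<comment> \<open>A block evaluates its argument on its own index set only, so the restriction has no effect.\<close>
  also have "(\<lambda>m \<omega>. block (y1 m) (y2 m) (J m) (restrict (\<lambda>i. \<omega> i) (J m))) = (\<lambda>m. block (y1 m) (y2 m) (J m))"
    by (simp add: block_def fun_eq_iff)
  finally have indep: "N.indep_vars (\<lambda>_. borel) (\<lambda>m. block (y1 m) (y2 m) (J m)) {..<L}" .
  have "integrable ?N (block (y1 m) (y2 m) (J m))" if "m < L" for m
    using that y J(1)
    by (intro N.integrable_const_bound[of _ "infsum majorant UNIV"] AE_I2 block_bound block_measurable) auto
  hence "(LINT \<omega>|?N. (\<Prod>m<L. block (y1 m) (y2 m) (J m) \<omega>)) = (\<Prod>m<L. LINT \<omega>|?N. block (y1 m) (y2 m) (J m) \<omega>)"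
    by (intro N.indep_vars_lebesgue_integral indep) auto
  also have "\<dots> = (\<Prod>m<L. \<Sum>\<^sub>\<infinity>(k1, k2). b k1 k2 * \<alpha> k1 k2 ^ card (J m) * y1 m ^ k1 * y2 m ^ k2)"
    using y J(1) by (intro prod.cong refl infsumI[symmetric] block_expectation) auto
  finally show ?thesis .
qed

end

lemma integral_auxiliary_space:
  fixes \<Phi> :: "(nat \<Rightarrow> nat) \<Rightarrow> ('i \<Rightarrow> 'w) \<Rightarrow> complex"
  assumes M: "prob_space M"
    and meas: "\<And>g. g permutes {1..n} \<Longrightarrow> \<Phi> g \<in> borel_measurable (PiM UNIV (\<lambda>_. M))"
    and bound: "\<And>g \<omega>. g permutes {1..n} \<Longrightarrow> \<omega> \<in> space (PiM UNIV (\<lambda>_. M)) \<Longrightarrow> norm (\<Phi> g \<omega>) \<le> C g"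
  shows "(LINT (g, \<omega>)|auxiliary_space M n. \<Phi> g \<omega>) =
    (\<Sum>g | g permutes {1..n}. LINT \<omega>|PiM UNIV (\<lambda>_. M). \<Phi> g \<omega>) / fact n"
proof -
  let ?N = "PiM UNIV (\<lambda>_::'i. M)" and ?P = "{g. g permutes {1..n}}"
  let ?U = "uniform_count_measure ?P"
  have fin: "finite ?P" by (simp add: finite_permutations)
  have "id \<in> ?P" by (simp add: permutes_id)
  hence "?P \<noteq> {}" by blast
  interpret U: prob_space ?U using fin \<open>?P \<noteq> {}\<close> by (rule prob_space_uniform_count_measure)
  interpret N: prob_space ?N by (intro prob_space_PiM M)
  interpret P: pair_prob_space ?U ?N ..
  have "case_prod \<Phi> \<in> borel_measurable (count_space ?P \<Otimes>\<^sub>M ?N)"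
    by (rule measurable_pair_measure_countable1) (use fin meas in \<open>auto intro: countable_finite\<close>)
  also have "borel_measurable (count_space ?P \<Otimes>\<^sub>M ?N) = borel_measurable (?U \<Otimes>\<^sub>M ?N)"
    by (intro measurable_cong_sets sets_pair_measure_cong refl sets_uniform_count_measure_count_space[symmetric])
  moreover have "norm (\<Phi> g \<omega>) \<le> (\<Sum>g\<in>?P. \<bar>C g\<bar>)" if "g \<in> ?P" "\<omega> \<in> space ?N" for g \<omega>
  proof -
    have "norm (\<Phi> g \<omega>) \<le> \<bar>C g\<bar>" using bound[of g \<omega>] that by simp
    also have "\<dots> \<le> (\<Sum>g\<in>?P. \<bar>C g\<bar>)" using that fin by (intro member_le_sum) auto
    finally show ?thesis .
  qed
  ultimately have "integrable (?U \<Otimes>\<^sub>M ?N) (case_prod \<Phi>)"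
    by (intro P.P.integrable_const_bound[of _ "\<Sum>g\<in>?P. \<bar>C g\<bar>"] AE_I2)
       (auto simp: space_pair_measure space_uniform_count_measure)
  hence "(LINT (g, \<omega>)|auxiliary_space M n. \<Phi> g \<omega>) = (LINT g|?U. LINT \<omega>|?N. \<Phi> g \<omega>)"
    unfolding auxiliary_space_def by (subst P.integral_fst'[symmetric]) auto
  also have "\<dots> = (\<Sum>g\<in>?P. (1 / card ?P) *\<^sub>R (LINT \<omega>|?N. \<Phi> g \<omega>))"
    unfolding uniform_count_measure_def using fin
    by (subst lebesgue_integral_point_measure_finite) auto
  also have "\<dots> = (\<Sum>g\<in>?P. LINT \<omega>|?N. \<Phi> g \<omega>) / fact n"
    by (simp add: scaleR_conv_of_real card_permutations sum_divide_distrib)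
  finally show ?thesis .
qed

section \<open>Asymptotics of the randomized class functions\<close>

text \<open>
  The common analytic core of both statements, for cycle weights that are power sums over an
  arbitrary index type. The index \<open>k0\<close> with \<open>w k0 = 1\<close> produces the power of \<open>n\<close>, all other indices
  produce the infinite product. In the second case the decay rate \<open>R\<close> is left free below \<open>1 / \<rho>\<close>, so
  that one rate can serve for several choices of \<open>\<beta>\<close> and \<open>w\<close>.
\<close>

lemma cycle_weight_sum_asymptotics:
  fixes \<beta> w :: "'k \<Rightarrow> complex" and c E :: "nat \<Rightarrow> complex"
  assumes rho: "0 < \<rho>" "\<rho> < 1"
    and wo: "w k0 = 1" and w: "\<And>k. k \<noteq> k0 \<Longrightarrow> norm (w k) \<le> \<rho>"
    and summable: "(\<lambda>k. norm (\<beta> k * w k)) summable_on UNIV"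
    and c: "\<And>l. l > 0 \<Longrightarrow> c l = (\<Sum>\<^sub>\<infinity>k. \<beta> k * w k ^ l)"
    and E: "\<And>n. E n = cycle_weight_sum c {1..n} / fact n"
  shows "\<beta> k0 \<notin> \<int>\<^sub>\<le>\<^sub>0 \<Longrightarrow>
      \<exists>P. has_unordered_prod (\<lambda>k. (1 - w k) powr (- \<beta> k)) P (- {k0}) \<and>
          E \<sim>[sequentially] (\<lambda>n. of_nat n powr (\<beta> k0 - 1) / Gamma (\<beta> k0) * P)"
    and "\<beta> k0 \<in> \<int>\<^sub>\<le>\<^sub>0 \<Longrightarrow> 1 < R \<Longrightarrow> R < 1 / \<rho> \<Longrightarrow> E \<in> O(\<lambda>n. of_real (1 / R ^ n))"
proof -
  have w': "norm (w k) \<le> \<rho>" if "k \<in> - {k0}" for k using w that by auto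
  have summable': "(\<lambda>k. norm (\<beta> k * w k)) summable_on - {k0}"
    using summable by (rule summable_on_subset_banach) auto
  note prod = has_unordered_prod_powr[OF rho w' summable']
  define d where "d l = (\<Sum>\<^sub>\<infinity>k\<in>- {k0}. \<beta> k * w k ^ l)" for l
  have split: "c l = \<beta> k0 + d l" if "l > 0" for l
  proof -
    have "((\<lambda>k. \<beta> k * w k ^ l) has_sum (\<beta> k0 * w k0 ^ l + d l)) (insert k0 (- {k0}))"
      unfolding d_def using prod(2)[OF _ that] by (intro has_sum_insert) auto
    also have "insert k0 (- {k0}) = UNIV" by auto
    finally show ?thesis unfolding c[OF that] by (simp add: infsumI wo)
  qed
  have E0: "E 0 = 1"
    using cycle_weight_sum_recurrence(1)[of c] by (simp add: E)
  have rec: "of_nat n * E n = (\<Sum>l=1..n. (\<beta> k0 + d l) * E (n - l))" if "n > 0" for n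
  proof -
    have "of_nat n * E n = (\<Sum>l=1..n. c l * E (n - l))"
      using cycle_weight_sum_recurrence(2)[OF that, of c] by (simp add: E)
    also have "\<dots> = (\<Sum>l=1..n. (\<beta> k0 + d l) * E (n - l))"
      by (intro sum.cong) (auto simp: split)
    finally show ?thesis .
  qed
  have d_bound: "norm (d l) \<le> (\<Sum>\<^sub>\<infinity>k\<in>- {k0}. norm (\<beta> k * w k)) / \<rho> * \<rho> ^ l" if "l > 0" for l
    using prod(3)[OF _ that] by (simp add: d_def)
  note asymp = recurrence_asymptotics[OF rho d_bound E0 rec]
  show "E \<in> O(\<lambda>n. of_real (1 / R ^ n))" if "\<beta> k0 \<in> \<int>\<^sub>\<le>\<^sub>0" "1 < R" "R < 1 / \<rho>"
    using asymp(2)[OF _ _ that] by simp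
  assume "\<beta> k0 \<notin> \<int>\<^sub>\<le>\<^sub>0"
  with asymp(1) prod(1)
  show "\<exists>P. has_unordered_prod (\<lambda>k. (1 - w k) powr (- \<beta> k)) P (- {k0}) \<and>
      E \<sim>[sequentially] (\<lambda>n. of_nat n powr (\<beta> k0 - 1) / Gamma (\<beta> k0) * P)"
    unfolding d_def by blast
qed

context random_torus_series
begin

text \<open>
  Here \<open>J m l\<close> is the block of indices of the cycle number \<open>m\<close> when that cycle has length \<open>l\<close>. The
  sum over \<open>g\<close> and the factorial together form the average over the permutations.
\<close>

lemma cycle_blocks_expectation:
  fixes J :: "nat \<Rightarrow> nat \<Rightarrow> 'i set"
  assumes J: "\<And>m l. finite (J m l)" "\<And>m l. card (J m l) = e l"
    and disj: "\<And>m m' l l'. m \<noteq> m' \<Longrightarrow> J m l \<inter> J m' l' = {}"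
  shows "(LINT (g, \<omega>)|auxiliary_space M n. (\<Prod>m<length (cycle_type n g).
            block (x1 ^ (cycle_type n g ! m)) (x2 ^ (cycle_type n g ! m)) (J m (cycle_type n g ! m)) \<omega>))
       = cycle_weight_sum (\<lambda>l. \<Sum>\<^sub>\<infinity>(k1, k2). b k1 k2 * \<alpha> k1 k2 ^ e l * (x1 ^ l) ^ k1 * (x2 ^ l) ^ k2) {1..n} / fact n"
proof -
  define c where "c l = (\<Sum>\<^sub>\<infinity>(k1, k2). b k1 k2 * \<alpha> k1 k2 ^ e l * (x1 ^ l) ^ k1 * (x2 ^ l) ^ k2)" for l
  define B where "B g m = block (x1 ^ (cycle_type n g ! m)) (x2 ^ (cycle_type n g ! m)) (J m (cycle_type n g ! m))" for g m
  have y: "norm (x1 ^ l) \<le> norm x1" "norm (x2 ^ l) \<le> norm x2" if "l > 0" for l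
    using that x_less power_decreasing[of 1 l "norm x1"] power_decreasing[of 1 l "norm x2"]
    by (simp_all add: norm_power Suc_le_eq)
  have "(LINT (g, \<omega>)|auxiliary_space M n. (\<Prod>m<length (cycle_type n g). B g m \<omega>)) =
      (\<Sum>g | g permutes {1..n}. LINT \<omega>|PiM UNIV (\<lambda>_. M). (\<Prod>m<length (cycle_type n g). B g m \<omega>)) / fact n"
  proof (rule integral_auxiliary_space[OF prob])
    fix g assume g: "g permutes {1..n}"
    show "(\<lambda>\<omega>. \<Prod>m<length (cycle_type n g). B g m \<omega>) \<in> borel_measurable (PiM UNIV (\<lambda>_. M))"
      unfolding B_def using y cycle_type_pos[OF g] J(1)
      by (intro borel_measurable_prod block_measurable) auto
    fix \<omega> :: "'i \<Rightarrow> 'w" assume \<omega>: "\<omega> \<in> space (PiM UNIV (\<lambda>_. M))"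
    have "norm (\<Prod>m<length (cycle_type n g). B g m \<omega>) \<le> (\<Prod>m<length (cycle_type n g). infsum majorant UNIV)"
      unfolding prod_norm[symmetric] B_def using y cycle_type_pos[OF g] J(1) \<omega>
      by (intro prod_mono conjI norm_ge_zero block_bound[where I = UNIV]) auto
    thus "norm (\<Prod>m<length (cycle_type n g). B g m \<omega>) \<le> infsum majorant UNIV ^ length (cycle_type n g)"
      by simp
  qed
  also have "(\<Sum>g | g permutes {1..n}. LINT \<omega>|PiM UNIV (\<lambda>_. M). (\<Prod>m<length (cycle_type n g). B g m \<omega>)) =
      (\<Sum>g | g permutes {1..n}. \<Prod>m<length (cycle_type n g). c (cycle_type n g ! m))"
    unfolding B_def
    by (intro sum.cong refl, subst prod_block_expectation)
       (use y cycle_type_pos J disj in \<open>auto simp: c_def disjoint_family_on_def\<close>)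
  also have "\<dots> = cycle_weight_sum c {1..n}"
    unfolding cycle_weight_sum_def by (intro sum.cong refl prod_cycle_type)
  finally show ?thesis unfolding B_def c_def .
qed

lemma EW1_eq:
  "EW1 M \<theta> \<eta> f x1 x2 n = cycle_weight_sum
     (\<lambda>l. \<Sum>\<^sub>\<infinity>(k1, k2). b k1 k2 * \<alpha> k1 k2 * (x1 ^ k1 * x2 ^ k2) ^ l) {1..n} / fact n"
  using cycle_blocks_expectation[of "\<lambda>m l. {m}" "\<lambda>_. 1" n]
  by (simp add: EW1_def W1_def block_def Let_def mult.commute mult.left_commute
        power_mult_distrib flip: power_mult)

lemma EW2_eq:
  "EW2 M \<theta> \<eta> f x1 x2 n = cycle_weight_sum
     (\<lambda>l. \<Sum>\<^sub>\<infinity>(k1, k2). b k1 k2 * (\<alpha> k1 k2 * x1 ^ k1 * x2 ^ k2) ^ l) {1..n} / fact n"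
proof -
  have disj: "({m} \<times> {..<l}) \<inter> ({m'} \<times> {..<l'}) = {}" if "m \<noteq> m'" for m m' l l' :: nat
    using that by auto
  have "(\<Prod>j\<in>{m} \<times> {..<l}. F j) = (\<Prod>i<l. F (m, i))" for F :: "nat \<times> nat \<Rightarrow> complex" and m l
    using prod.cartesian_product[of "\<lambda>x y. F (x, y)" "{..<l}" "{m}"] by simp
  thus ?thesis
    using cycle_blocks_expectation[of "\<lambda>m l. {m} \<times> {..<l}" "\<lambda>l. l" n, OF _ _ disj]
    by (simp add: EW2_def W2_def block_def Let_def mult_ac power_mult_distrib flip: power_mult)
qed

lemma asymptotics:
  shows "b 0 0 \<notin> \<int>\<^sub>\<le>\<^sub>0 \<Longrightarrow>
      \<exists>P. has_unordered_prod (\<lambda>(k1, k2). (1 - x1 ^ k1 * x2 ^ k2) powr (- b k1 k2 * \<alpha> k1 k2)) P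
            {(k1, k2). k1 + k2 \<noteq> 0} \<and>
          EW1 M \<theta> \<eta> f x1 x2 \<sim>[sequentially] (\<lambda>n. of_nat n powr (b 0 0 - 1) / Gamma (b 0 0) * P)"
    and "b 0 0 \<notin> \<int>\<^sub>\<le>\<^sub>0 \<Longrightarrow>
      \<exists>P. has_unordered_prod (\<lambda>(k1, k2). (1 - \<alpha> k1 k2 * x1 ^ k1 * x2 ^ k2) powr (- b k1 k2)) P
            {(k1, k2). k1 + k2 \<noteq> 0} \<and>
          EW2 M \<theta> \<eta> f x1 x2 \<sim>[sequentially] (\<lambda>n. of_nat n powr (b 0 0 - 1) / Gamma (b 0 0) * P)"
    and "b 0 0 \<in> \<int>\<^sub>\<le>\<^sub>0 \<Longrightarrow> \<exists>\<delta>::real. \<delta> > 0 \<and>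
      EW1 M \<theta> \<eta> f x1 x2 \<in> O(\<lambda>n. of_real (1 / (1 + \<delta>) ^ n)) \<and>
      EW2 M \<theta> \<eta> f x1 x2 \<in> O(\<lambda>n. of_real (1 / (1 + \<delta>) ^ n))"
proof -
  \<comment> \<open>The lower bound \<open>1 / 2\<close> only keeps \<open>\<rho>\<close> positive when \<open>x1\<close> and \<open>x2\<close> both vanish.\<close>
  define \<rho> where "\<rho> = max (1 / 2) (max (norm x1) (norm x2))"
  have rho: "0 < \<rho>" "\<rho> < 1" using x_less by (auto simp: \<rho>_def)
  define w1 w2 \<beta>1 \<beta>2 where "w1 = (\<lambda>(k1, k2). x1 ^ k1 * x2 ^ k2)"
    and "w2 = (\<lambda>(k1, k2). \<alpha> k1 k2 * x1 ^ k1 * x2 ^ k2)"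
    and "\<beta>1 = (\<lambda>(k1, k2). b k1 k2 * \<alpha> k1 k2)" and "\<beta>2 = (\<lambda>(k1, k2). b k1 k2)"
  have w1: "norm (w1 k) \<le> \<rho>" if "k \<noteq> (0, 0)" for k
  proof -
    obtain k1 k2 where k: "k = (k1, k2)" by (cases k)
    have "norm (w1 k) = norm x1 ^ k1 * norm x2 ^ k2" by (simp add: w1_def k norm_mult norm_power)
    also have "\<dots> \<le> \<rho> ^ k1 * \<rho> ^ k2"
      using rho by (intro mult_mono power_mono) (auto simp: \<rho>_def)
    also have "\<dots> = \<rho> ^ (k1 + k2)" by (simp add: power_add)
    also have "\<dots> \<le> \<rho> ^ 1" using rho that k by (intro power_decreasing) auto
    finally show ?thesis by simp
  qed
  have w2_eq: "w2 k = case_prod \<alpha> k * w1 k" for k by (simp add: w2_def w1_def case_prod_unfold)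
  have w2_w1: "norm (w2 k) \<le> norm (w1 k)" for k
    using mult_right_mono[OF norm_alpha[of "fst k" "snd k"], of "norm (w1 k)"]
    by (simp add: w2_eq norm_mult case_prod_unfold)
  hence w2: "norm (w2 k) \<le> \<rho>" if "k \<noteq> (0, 0)" for k
    using w1[OF that] order.trans by blast
  have one: "w1 (0, 0) = 1" "w2 (0, 0) = 1" by (simp_all add: w1_def w2_def)
  have eq: "norm (\<beta>1 k * w1 k) = norm (\<beta>2 k * w2 k)" for k
    by (simp add: w1_def w2_def \<beta>1_def \<beta>2_def case_prod_unfold mult_ac)
  have "norm (\<beta>2 k * w2 k) \<le> majorant k" for k
    using mult_left_mono[OF w2_w1, of "norm (\<beta>2 k)" k]
    by (simp add: w1_def \<beta>2_def majorant_def case_prod_unfold norm_mult norm_power mult_ac)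
  hence sum2: "(\<lambda>k. norm (\<beta>2 k * w2 k)) summable_on UNIV"
    by (intro summable_on_comparison_test[OF majorant_summable]) auto
  hence sum1: "(\<lambda>k. norm (\<beta>1 k * w1 k)) summable_on UNIV" by (simp add: eq)
  have K: "- {(0, 0)} = {(k1, k2). k1 + k2 \<noteq> (0::nat)}" by auto
  have b00: "\<beta>1 (0, 0) = b 0 0" "\<beta>2 (0, 0) = b 0 0" by (simp_all add: \<beta>1_def \<beta>2_def)
  have E1: "EW1 M \<theta> \<eta> f x1 x2 n = cycle_weight_sum (\<lambda>l. \<Sum>\<^sub>\<infinity>k. \<beta>1 k * w1 k ^ l) {1..n} / fact n" for n
    by (simp add: EW1_eq \<beta>1_def w1_def case_prod_unfold)
  have E2: "EW2 M \<theta> \<eta> f x1 x2 n = cycle_weight_sum (\<lambda>l. \<Sum>\<^sub>\<infinity>k. \<beta>2 k * w2 k ^ l) {1..n} / fact n" for n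
    by (simp add: EW2_eq \<beta>2_def w2_def case_prod_unfold)
  note asymp1 = cycle_weight_sum_asymptotics[OF rho one(1) w1 sum1 refl E1, unfolded b00 K]
  note asymp2 = cycle_weight_sum_asymptotics[OF rho one(2) w2 sum2 refl E2, unfolded b00 K]
  show "\<exists>P. has_unordered_prod (\<lambda>(k1, k2). (1 - x1 ^ k1 * x2 ^ k2) powr (- b k1 k2 * \<alpha> k1 k2)) P
            {(k1, k2). k1 + k2 \<noteq> 0} \<and>
          EW1 M \<theta> \<eta> f x1 x2 \<sim>[sequentially] (\<lambda>n. of_nat n powr (b 0 0 - 1) / Gamma (b 0 0) * P)"
    if "b 0 0 \<notin> \<int>\<^sub>\<le>\<^sub>0"
    using asymp1(1)[OF _ that] by (simp add: \<beta>1_def w1_def case_prod_unfold)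
  show "\<exists>P. has_unordered_prod (\<lambda>(k1, k2). (1 - \<alpha> k1 k2 * x1 ^ k1 * x2 ^ k2) powr (- b k1 k2)) P
            {(k1, k2). k1 + k2 \<noteq> 0} \<and>
          EW2 M \<theta> \<eta> f x1 x2 \<sim>[sequentially] (\<lambda>n. of_nat n powr (b 0 0 - 1) / Gamma (b 0 0) * P)"
    if "b 0 0 \<notin> \<int>\<^sub>\<le>\<^sub>0"
    using asymp2(1)[OF _ that] by (simp add: \<beta>2_def w2_def case_prod_unfold)
  obtain R where R: "1 < R" "R < 1 / \<rho>"
    using dense[of 1 "1 / \<rho>"] rho by auto
  show "\<exists>\<delta>::real. \<delta> > 0 \<and>
      EW1 M \<theta> \<eta> f x1 x2 \<in> O(\<lambda>n. of_real (1 / (1 + \<delta>) ^ n)) \<and>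
      EW2 M \<theta> \<eta> f x1 x2 \<in> O(\<lambda>n. of_real (1 / (1 + \<delta>) ^ n))" if "b 0 0 \<in> \<int>\<^sub>\<le>\<^sub>0"
    using asymp1(2)[OF _ that R] asymp2(2)[OF _ that R] R(1)
    by (intro exI[of _ "R - 1"]) simp
qed

end

theorem theorem6p1:
  fixes r1 r2 :: real
    and f :: "complex \<times> complex \<Rightarrow> complex"
    and b :: "nat \<Rightarrow> nat \<Rightarrow> complex"
    and M :: "'w measure"
    and \<theta> \<eta> :: "'w \<Rightarrow> complex"
    and \<alpha> :: "nat \<Rightarrow> nat \<Rightarrow> complex"
    and x1 x2 :: complex
  assumes "r1 > 0" and "r2 > 0"
    and "holomorphic2_on f (ball 0 r1 \<times> ball 0 r2)"
    and "\<And>z1 z2. z1 \<in> ball 0 r1 \<Longrightarrow> z2 \<in> ball 0 r2 \<Longrightarrow>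
           ((\<lambda>(k1, k2). b k1 k2 * z1 ^ k1 * z2 ^ k2) has_sum f (z1, z2)) UNIV"
    and "prob_space M"
    and "\<theta> \<in> borel_measurable M" and "\<eta> \<in> borel_measurable M"
    and "\<And>\<omega>. \<omega> \<in> space M \<Longrightarrow> \<theta> \<omega> \<in> sphere 0 1"
    and "\<And>\<omega>. \<omega> \<in> space M \<Longrightarrow> \<eta> \<omega> \<in> sphere 0 1"
    and "\<And>k1 k2. \<alpha> k1 k2 = (LINT \<omega>|M. \<theta> \<omega> ^ k1 * \<eta> \<omega> ^ k2)"
    and "norm x1 < min r1 1" and "norm x2 < min r2 1"
  shows "(b 0 0 \<notin> \<int>\<^sub>\<le>\<^sub>0 \<longrightarrow>
            (\<exists>P. has_unordered_prod
                   (\<lambda>(k1, k2). (1 - x1 ^ k1 * x2 ^ k2) powr (- b k1 k2 * \<alpha> k1 k2)) P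
                   {(k1, k2). k1 + k2 \<noteq> 0} \<and>
                 EW1 M \<theta> \<eta> f x1 x2 \<sim>[sequentially]
                   (\<lambda>n. of_nat n powr (b 0 0 - 1) / Gamma (b 0 0) * P)) \<and>
            (\<exists>P. has_unordered_prod
                   (\<lambda>(k1, k2). (1 - \<alpha> k1 k2 * x1 ^ k1 * x2 ^ k2) powr (- b k1 k2)) P
                   {(k1, k2). k1 + k2 \<noteq> 0} \<and>
                 EW2 M \<theta> \<eta> f x1 x2 \<sim>[sequentially]
                   (\<lambda>n. of_nat n powr (b 0 0 - 1) / Gamma (b 0 0) * P)))
       \<and> (b 0 0 \<in> \<int>\<^sub>\<le>\<^sub>0 \<longrightarrow>
            (\<exists>\<delta>::real. \<delta> > 0 \<and>
               EW1 M \<theta> \<eta> f x1 x2 \<in> O(\<lambda>n. of_real (1 / (1 + \<delta>) ^ n)) \<and>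
               EW2 M \<theta> \<eta> f x1 x2 \<in> O(\<lambda>n. of_real (1 / (1 + \<delta>) ^ n))))"
proof -
  interpret random_torus_series f b M \<theta> \<eta> \<alpha> x1 x2
  proof (rule random_torus_series.intro)
    show "((\<lambda>(k1, k2). b k1 k2 * z1 ^ k1 * z2 ^ k2) has_sum f (z1, z2)) UNIV"
      if "norm z1 \<le> norm x1" "norm z2 \<le> norm x2" for z1 z2
      using that assms(11,12) by (intro assms(4)) auto
    show "prob_space M" by (rule assms(5))
    show "\<theta> \<in> borel_measurable M" "\<eta> \<in> borel_measurable M" by (rule assms(6,7))+
    show "norm (\<theta> \<omega>) = 1" "norm (\<eta> \<omega>) = 1" if "\<omega> \<in> space M" for \<omega>
      using assms(8,9)[OF that] by simp_all
    show "\<alpha> k1 k2 = (LINT \<omega>|M. \<theta> \<omega> ^ k1 * \<eta> \<omega> ^ k2)" for k1 k2 by (rule assms(10))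
    show "norm x1 < 1" "norm x2 < 1" using assms(11,12) by simp_all
  qed
  show ?thesis using asymptotics by blast
qed

end
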